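(* Let $k$ be an algebraically closed field of characteristic $p>0$, let $\mathfrak g$ be a finite dimensional restricted $p$-Lie algebra over $k$, and let $\Gamma$ be the finite group scheme over $k$ such that $\mathcal{O}(\Gamma)=u(\mathfrak g)^*$. Then every associator for $u(\mathfrak g)^*$ is of the form $E(\phi)$ for a unique $\phi\in Z^3(\Gamma,\mathbb{G}_a)$.
   Context: $u(\mathfrak g)$ is the restricted enveloping algebra and $A:=u(\mathfrak g)^*$ its dual, a commutative Hopf algebra that is local with augmentation ideal $I$ satisfying $x^p=0$ for all $x\in I$. An associator for $A$ is an invertible $\Phi\in A^{\otimes3}$ making the Hopf algebra $A$ (with its given comultiplication and counit) a quasi-Hopf algebra; since $A$ is commutative this means $(\mathrm{id}\otimes\mathrm{id}\otimes\Delta)(\Phi)(\Delta\otimes\mathrm{id}\otimes\mathrm{id})(\Phi)=(1\otimes\Phi)(\mathrm{id}\otimes\Delta\otimes\mathrm{id})(\Phi)(\Phi\otimes1)$ and applying the counit to any tensor factor of $\Phi$ gives $1$. $Z^3(\Gamma,\mathbb{G}_a)$ is the group of normalized additive (Hochschild) $3$-cocycles of $\Gamma$ with trivial coefficients, i.e. $\phi\in I^{\otimes3}$ with $(\mathrm{id}\otimes\mathrm{id}\otimes\Delta)(\phi)+(\Delta\otimes\mathrm{id}\otimes\mathrm{id})(\phi)=1\otimes\phi+(\mathrm{id}\otimes\Delta\otimes\mathrm{id})(\phi)+\phi\otimes1$. $E:(I^{\otimes3},+)\to(1+I^{\otimes3},\times)$ is the unique homomorphism of unipotent algebraic groups with $E(T)=\sum_{j=0}^{p-1}T^j/j!$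 for every decomposable $T=a_1\otimes a_2\otimes a_3$, $a_i\in I$. *)

theory Defs
  imports
    "HOL-Library.Poly_Mapping"
    "HOL-Library.Product_Plus"
    "HOL-Library.Function_Algebras"
    "HOL-Library.FuncSet"
    "HOL-Computational_Algebra.Polynomial"
begin

section \<open>Free associative algebras\<close>

datatype 'a word = Word "'a list"

instantiation word :: (type) monoid_add
begin

definition zero_word :: "'a word" where "0 = Word []"

fun plus_word :: "'a word \<Rightarrow> 'a word \<Rightarrow> 'a word" where
  "Word u + Word v = Word (u @ v)"

instance
proof
  fix a b c :: "'a word"
  show "a + b + c = a + (b + c)" by (cases a; cases b; cases c) simp
  show "0 + a = a" by (cases a) (simp add: zero_word_def)
  show "a + 0 = a" by (cases a) (simp add: zero_word_def)
qed

end

text \<open>The monoid algebra of the free monoid: the free associative unital algebra on the set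
  \<^typ>\<open>'g\<close>.  Its tensor square is the monoid algebra of the product monoid.\<close>

type_synonym ('g, 'k) free_algebra = "'g word \<Rightarrow>\<^sub>0 'k"
type_synonym ('g, 'k) free_algebra_sq = "('g word \<times> 'g word) \<Rightarrow>\<^sub>0 'k"

text \<open>Residue classes modulo an ideal, and functions of one to four residue classes.\<close>

type_synonym ('g, 'k) residue_class = "('g, 'k) free_algebra set"
type_synonym ('g, 'k) form1 = "('g, 'k) residue_class \<Rightarrow> 'k"
type_synonym ('g, 'k) form2 =
  "('g, 'k) residue_class \<times> ('g, 'k) residue_class \<Rightarrow> 'k"
type_synonym ('g, 'k) form3 =
  "('g, 'k) residue_class \<times> ('g, 'k) residue_class \<times> ('g, 'k) residue_class \<Rightarrow> 'k"
type_synonym ('g, 'k) form4 =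
  "('g, 'k) residue_class \<times> ('g, 'k) residue_class \<times> ('g, 'k) residue_class \<times>
    ('g, 'k) residue_class \<Rightarrow> 'k"

definition gen :: "'g \<Rightarrow> ('g, 'k::field) free_algebra" where
  "gen x = Poly_Mapping.single (Word [x]) 1"

definition scalar :: "'k::field \<Rightarrow> ('m::monoid_add \<Rightarrow>\<^sub>0 'k)" where
  "scalar c = Poly_Mapping.single 0 c"

text \<open>The algebra homomorphism that sends each generator \<open>x\<close> to \<open>x \<otimes> 1 + 1 \<otimes> x\<close>.\<close>

fun comult_word :: "'g word \<Rightarrow> ('g, 'k::field) free_algebra_sq" where
  "comult_word (Word xs) =
     prod_list (map (\<lambda>x. Poly_Mapping.single (Word [x], 0) 1 + Poly_Mapping.single (0, Word [x]) 1) xs)"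

definition free_comult :: "('g, 'k::field) free_algebra \<Rightarrow> ('g, 'k) free_algebra_sq" where
  "free_comult t = (\<Sum>w\<in>Poly_Mapping.keys t. scalar (Poly_Mapping.lookup t w) * comult_word w)"

inductive_set ideal_gen :: "'r::ring_1 set \<Rightarrow> 'r set" for S where
  base: "s \<in> S \<Longrightarrow> s \<in> ideal_gen S"
| zero: "0 \<in> ideal_gen S"
| add: "s \<in> ideal_gen S \<Longrightarrow> t \<in> ideal_gen S \<Longrightarrow> s + t \<in> ideal_gen S"
| lmult: "s \<in> ideal_gen S \<Longrightarrow> r * s \<in> ideal_gen S"
| rmult: "s \<in> ideal_gen S \<Longrightarrow> s * r \<in> ideal_gen S"


section \<open>Spaces of functions\<close>

definition fscale :: "'k::field \<Rightarrow> ('x \<Rightarrow> 'k) \<Rightarrow> ('x \<Rightarrow> 'k)" where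
  "fscale c f = (\<lambda>x. c * f x)"

definition fspan :: "('x \<Rightarrow> 'k::field) set \<Rightarrow> ('x \<Rightarrow> 'k) set" where
  "fspan = module.span fscale"

lemma vector_space_fscale: "vector_space (fscale :: 'k::field \<Rightarrow> ('x \<Rightarrow> 'k) \<Rightarrow> _)"
  by unfold_locales (auto simp: fscale_def plus_fun_def algebra_simps)

text \<open>Polynomial functions on a space of functions \<open>'x \<Rightarrow> 'k\<close>, the evaluations at points of \<open>'x\<close>
  serving as coordinates.  On a finite-dimensional subspace the evaluations span the linear forms,
  so that the restrictions of these functions are precisely the regular functions of the subspace
  viewed as an affine space.\<close>

inductive_set poly_functions :: "(('x \<Rightarrow> 'k::field) \<Rightarrow> 'k) set" where
  const: "(\<lambda>_. c) \<in> poly_functions"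
| coord: "(\<lambda>f. f x) \<in> poly_functions"
| add: "r \<in> poly_functions \<Longrightarrow> s \<in> poly_functions \<Longrightarrow> (\<lambda>f. r f + s f) \<in> poly_functions"
| mult: "r \<in> poly_functions \<Longrightarrow> s \<in> poly_functions \<Longrightarrow> (\<lambda>f. r f * s f) \<in> poly_functions"

definition regular_map_on :: "('x \<Rightarrow> 'k::field) set \<Rightarrow> (('x \<Rightarrow> 'k) \<Rightarrow> ('y \<Rightarrow> 'k)) \<Rightarrow> bool" where
  "regular_map_on V F \<longleftrightarrow> (\<forall>y. \<exists>r\<in>poly_functions. \<forall>f\<in>V. F f y = r f)"

text \<open>Over a field, the tensor product of spaces of functions on \<open>'x\<close> is realised, as usual, inside
  the functions on the cartesian product: the pure tensor \<open>a \<otimes> b \<otimes> c\<close> is the function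
  \<open>(x, y, z) \<mapsto> a x * b y * c z\<close>, and the tensor product is the span of the pure tensors.\<close>

definition pure2 :: "('x \<Rightarrow> 'k::field) \<Rightarrow> ('x \<Rightarrow> 'k) \<Rightarrow> ('x \<times> 'x \<Rightarrow> 'k)" where
  "pure2 a b = (\<lambda>(x, y). a x * b y)"

definition pure3 :: "('x \<Rightarrow> 'k::field) \<Rightarrow> ('x \<Rightarrow> 'k) \<Rightarrow> ('x \<Rightarrow> 'k) \<Rightarrow> ('x \<times> 'x \<times> 'x \<Rightarrow> 'k)" where
  "pure3 a b c = (\<lambda>(x, y, z). a x * b y * c z)"

definition pure4 :: "('x \<Rightarrow> 'k::field) \<Rightarrow> ('x \<Rightarrow> 'k) \<Rightarrow> ('x \<Rightarrow> 'k) \<Rightarrow> ('x \<Rightarrow> 'k) \<Rightarrow>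
    ('x \<times> 'x \<times> 'x \<times> 'x \<Rightarrow> 'k)" where
  "pure4 a b c d = (\<lambda>(x, y, z, w). a x * b y * c z * d w)"

definition tensor3 :: "('x \<Rightarrow> 'k::field) set \<Rightarrow> ('x \<times> 'x \<times> 'x \<Rightarrow> 'k) set" where
  "tensor3 V = fspan {pure3 a b c |a b c. a \<in> V \<and> b \<in> V \<and> c \<in> V}"


section \<open>Restricted Lie algebras\<close>

text \<open>Multiplication by the indeterminate \<open>\<lambda>\<close> is \<open>pCons 0\<close>; hence \<open>ad_pencil br x y\<close> is the operator
  \<open>ad (\<lambda>x + y)\<close> on polynomials in \<open>\<lambda>\<close> with coefficients in the Lie algebra.\<close>

definition ad_pencil ::
  "('g \<Rightarrow> 'g \<Rightarrow> 'g) \<Rightarrow> 'g \<Rightarrow> 'g \<Rightarrow> 'g::ab_group_add poly \<Rightarrow> 'g poly" where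
  "ad_pencil br x y q = pCons 0 (map_poly (br x) q) + map_poly (br y) q"

text \<open>In \<open>pmap_add\<close> the \<open>i\<close>-th summand is \<open>s\<^sub>i(x, y)\<close>, where \<open>i s\<^sub>i(x, y)\<close> is the coefficient of
  \<open>\<lambda>\<^bsup>i-1\<^esup>\<close> in \<open>ad (\<lambda>x + y)\<^bsup>p-1\<^esup> x\<close>.\<close>

locale restricted_lie_algebra = vector_space scale
  for scale :: "'k::field \<Rightarrow> 'g::ab_group_add \<Rightarrow> 'g" +
  fixes p :: nat
    and br :: "'g \<Rightarrow> 'g \<Rightarrow> 'g"
    and pmap :: "'g \<Rightarrow> 'g"
  assumes char_eq: "CHAR('k) = p"
    and char_pos: "p > 0"
    and br_add_left: "br (x + y) z = br x z + br y z"
    and br_add_right: "br x (y + z) = br x y + br x z"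
    and br_scale_left: "br (scale c x) y = scale c (br x y)"
    and br_scale_right: "br x (scale c y) = scale c (br x y)"
    and br_self: "br x x = 0"
    and jacobi: "br x (br y z) + br y (br z x) + br z (br x y) = 0"
    and pmap_ad: "br (pmap x) y = ((br x) ^^ p) y"
    and pmap_scale: "pmap (scale c x) = scale (c ^ p) (pmap x)"
    and pmap_add: "pmap (x + y) = pmap x + pmap y +
      (\<Sum>i\<in>{1..<p}. scale (inverse (of_nat i)) (coeff ((ad_pencil br x y ^^ (p - 1)) [:x:]) (i - 1)))"
begin

subsection \<open>The restricted enveloping algebra\<close>

definition relators :: "('g, 'k) free_algebra set" where
  "relators =
     {gen (x + y) - (gen x + gen y) |x y. True} \<union>
     {gen (scale c x) - scalar c * gen x |c x. True} \<union>
     {gen (br x y) - (gen x * gen y - gen y * gen x) |x y. True} \<union>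
     {gen (pmap x) - gen x ^ p |x. True}"

definition coset :: "('g, 'k) free_algebra \<Rightarrow> ('g, 'k) residue_class" where
  "coset t = {s. s - t \<in> ideal_gen relators}"

definition uea :: "('g, 'k) residue_class set" where
  "uea = range coset"

definition rep :: "('g, 'k) residue_class \<Rightarrow> ('g, 'k) free_algebra" where
  "rep X = (SOME t. t \<in> X)"

definition uea_mult ::
  "('g, 'k) residue_class \<Rightarrow> ('g, 'k) residue_class \<Rightarrow> ('g, 'k) residue_class" where
  "uea_mult X Y = coset (rep X * rep Y)"

definition uea_one :: "('g, 'k) residue_class" where
  "uea_one = coset 1"

lemma ideal_gen_uminus: "s \<in> ideal_gen S \<Longrightarrow> - s \<in> ideal_gen S"
  using ideal_gen.lmult[of s S "- 1"] by simp

lemma coset_eq_iff: "coset s = coset t \<longleftrightarrow> s - t \<in> ideal_gen relators"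
proof
  assume "coset s = coset t"
  moreover have "s \<in> coset s"
    by (simp add: coset_def ideal_gen.zero)
  ultimately show "s - t \<in> ideal_gen relators"
    by (simp add: coset_def)
next
  assume st: "s - t \<in> ideal_gen relators"
  show "coset s = coset t"
  proof (intro set_eqI iffI)
    fix u assume "u \<in> coset s"
    then show "u \<in> coset t"
      using ideal_gen.add[OF _ st, of "u - s"] by (simp add: coset_def)
  next
    fix u assume "u \<in> coset t"
    then show "u \<in> coset s"
      using ideal_gen.add[OF _ ideal_gen_uminus[OF st], of "u - t"] by (simp add: coset_def)
  qed
qed

lemma rep_coset: "rep (coset t) - t \<in> ideal_gen relators"
proof -
  have "t \<in> coset t"
    by (simp add: coset_def ideal_gen.zero)
  then have "rep (coset t) \<in> coset t"
    unfolding rep_def by (rule someI)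
  then show ?thesis
    by (simp add: coset_def)
qed

lemma uea_mult_coset: "uea_mult (coset s) (coset t) = coset (s * t)"
proof -
  have "(rep (coset s) - s) * rep (coset t) + s * (rep (coset t) - t) \<in> ideal_gen relators"
    by (intro ideal_gen.add ideal_gen.lmult ideal_gen.rmult rep_coset)
  then show ?thesis
    unfolding uea_mult_def coset_eq_iff by (simp add: algebra_simps)
qed

text \<open>The counit kills \<open>\<gg>\<close>; it is induced by the constant coefficient on the free algebra.\<close>

definition uea_counit :: "('g, 'k) form1" where
  "uea_counit X = (if X \<in> uea then Poly_Mapping.lookup (rep X) 0 else 0)"

text \<open>The comultiplication \<open>\<Delta>\<close> of the restricted enveloping algebra is induced by that of the free
  algebra; the ideal generated by the relators being a coideal, the choice of representatives is
  immaterial.  \<open>pair_comult \<beta> X\<close> is the value at \<open>\<Delta> X\<close> of the linear form on the tensor square that is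
  given by a bilinear form \<open>\<beta>\<close>, i.e. the sum of \<open>\<beta> X\<^sub>1 X\<^sub>2\<close> in Sweedler notation.\<close>

definition pair_comult ::
  "(('g, 'k) residue_class \<Rightarrow> ('g, 'k) residue_class \<Rightarrow> 'k) \<Rightarrow> ('g, 'k) residue_class \<Rightarrow> 'k" where
  "pair_comult \<beta> X =
     (if X \<in> uea
      then (\<Sum>(v, w)\<in>Poly_Mapping.keys (free_comult (rep X)).
              Poly_Mapping.lookup (free_comult (rep X)) (v, w) *
              \<beta> (coset (Poly_Mapping.single v 1)) (coset (Poly_Mapping.single w 1)))
      else 0)"


subsection \<open>The dual Hopf algebra\<close>

text \<open>Functions are extended by \<open>0\<close> outside the carrier \<open>uea\<close>.\<close>

definition dual :: "('g, 'k) form1 set" where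
  "dual = {f. (\<forall>s t. f (coset (s + t)) = f (coset s) + f (coset t)) \<and>
              (\<forall>c t. f (coset (scalar c * t)) = c * f (coset t)) \<and>
              (\<forall>X. X \<notin> uea \<longrightarrow> f X = 0)}"

definition dual_mult :: "('g, 'k) form1 \<Rightarrow> ('g, 'k) form1 \<Rightarrow> ('g, 'k) form1" where
  "dual_mult f g = pair_comult (\<lambda>x y. f x * g y)"

abbreviation dual_one :: "('g, 'k) form1" where
  "dual_one \<equiv> uea_counit"

definition dual_comult :: "('g, 'k) form1 \<Rightarrow> ('g, 'k) form2" where
  "dual_comult f = (\<lambda>(x, y). if x \<in> uea \<and> y \<in> uea then f (uea_mult x y) else 0)"

definition dual_counit :: "('g, 'k) form1 \<Rightarrow> 'k" where
  "dual_counit f = f uea_one"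

definition aug_ideal :: "('g, 'k) form1 set" where
  "aug_ideal = {f \<in> dual. dual_counit f = 0}"


subsection \<open>Tensor powers of the dual\<close>

definition one2 :: "('g, 'k) form2" where
  "one2 = pure2 dual_one dual_one"

definition one3 :: "('g, 'k) form3" where
  "one3 = pure3 dual_one dual_one dual_one"

text \<open>The products of the algebras \<open>A \<otimes> A \<otimes> A\<close> and \<open>A \<otimes> A \<otimes> A \<otimes> A\<close>, i.e. \<open>dual_mult\<close> in each
  tensor factor.\<close>

definition mult3 :: "('g, 'k) form3 \<Rightarrow> ('g, 'k) form3 \<Rightarrow> ('g, 'k) form3" where
  "mult3 F G = (\<lambda>(x, y, z).
     pair_comult (\<lambda>x1 x2. pair_comult (\<lambda>y1 y2. pair_comult (\<lambda>z1 z2.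
       F (x1, y1, z1) * G (x2, y2, z2)) z) y) x)"

definition mult4 :: "('g, 'k) form4 \<Rightarrow> ('g, 'k) form4 \<Rightarrow> ('g, 'k) form4" where
  "mult4 F G = (\<lambda>(x, y, z, w).
     pair_comult (\<lambda>x1 x2. pair_comult (\<lambda>y1 y2. pair_comult (\<lambda>z1 z2. pair_comult (\<lambda>w1 w2.
       F (x1, y1, z1, w1) * G (x2, y2, z2, w2)) w) z) y) x)"

definition power3 :: "('g, 'k) form3 \<Rightarrow> nat \<Rightarrow> ('g, 'k) form3" where
  "power3 F j = (mult3 F ^^ j) one3"

text \<open>\<open>comult1\<close>, \<open>comult2\<close>, \<open>comult3\<close> apply the comultiplication, and \<open>counit1\<close>, \<open>counit2\<close>,
  \<open>counit3\<close> the counit, in the first, second, third tensor factor; \<open>tensor_one_left F\<close> and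
  \<open>tensor_one_right F\<close> are \<open>1 \<otimes> F\<close> and \<open>F \<otimes> 1\<close>.\<close>

definition comult1 :: "('g, 'k) form3 \<Rightarrow> ('g, 'k) form4" where
  "comult1 F = (\<lambda>(x, y, z, w). dual_comult (\<lambda>t. F (t, z, w)) (x, y))"

definition comult2 :: "('g, 'k) form3 \<Rightarrow> ('g, 'k) form4" where
  "comult2 F = (\<lambda>(x, y, z, w). dual_comult (\<lambda>t. F (x, t, w)) (y, z))"

definition comult3 :: "('g, 'k) form3 \<Rightarrow> ('g, 'k) form4" where
  "comult3 F = (\<lambda>(x, y, z, w). dual_comult (\<lambda>t. F (x, y, t)) (z, w))"

definition counit1 :: "('g, 'k) form3 \<Rightarrow> ('g, 'k) form2" where
  "counit1 F = (\<lambda>(y, z). dual_counit (\<lambda>t. F (t, y, z)))"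

definition counit2 :: "('g, 'k) form3 \<Rightarrow> ('g, 'k) form2" where
  "counit2 F = (\<lambda>(x, z). dual_counit (\<lambda>t. F (x, t, z)))"

definition counit3 :: "('g, 'k) form3 \<Rightarrow> ('g, 'k) form2" where
  "counit3 F = (\<lambda>(x, y). dual_counit (\<lambda>t. F (x, y, t)))"

definition tensor_one_left :: "('g, 'k) form3 \<Rightarrow> ('g, 'k) form4" where
  "tensor_one_left F = (\<lambda>(x, y, z, w). dual_one x * F (y, z, w))"

definition tensor_one_right :: "('g, 'k) form3 \<Rightarrow> ('g, 'k) form4" where
  "tensor_one_right F = (\<lambda>(x, y, z, w). F (x, y, z) * dual_one w)"

lemma pair_comult_scale_right: "pair_comult (\<lambda>x y. c * \<beta> x y) X = c * pair_comult \<beta> X"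
  by (simp add: pair_comult_def sum_distrib_left case_prod_beta mult_ac)

lemma mult3_pure:
  "mult3 (pure3 a b c) (pure3 a' b' c') = pure3 (dual_mult a a') (dual_mult b b') (dual_mult c c')"
proof
  fix X
  have h1: "pair_comult (\<lambda>z1 z2. a x1 * b y1 * c z1 * (a' x2 * b' y2 * c' z2)) z =
        (a x1 * a' x2) * ((b y1 * b' y2) * dual_mult c c' z)" for x1 y1 x2 y2 z
  proof -
    have "pair_comult (\<lambda>z1 z2. a x1 * b y1 * c z1 * (a' x2 * b' y2 * c' z2)) z =
          pair_comult (\<lambda>z1 z2. (a x1 * a' x2 * (b y1 * b' y2)) * (c z1 * c' z2)) z"
      by (rule arg_cong[where f = "\<lambda>\<beta>. pair_comult \<beta> z"]) (auto intro!: ext simp: mult_ac)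
    then show ?thesis
      by (simp only: pair_comult_scale_right) (simp add: dual_mult_def mult_ac)
  qed
  have h2: "pair_comult (\<lambda>y1 y2. a x1 * a' x2 * (b y1 * b' y2 * r)) y =
        (a x1 * a' x2) * (dual_mult b b' y * r)" for x1 x2 y r
  proof -
    have "pair_comult (\<lambda>y1 y2. a x1 * a' x2 * (b y1 * b' y2 * r)) y =
          pair_comult (\<lambda>y1 y2. (a x1 * a' x2 * r) * (b y1 * b' y2)) y"
      by (rule arg_cong[where f = "\<lambda>\<beta>. pair_comult \<beta> y"]) (auto intro!: ext simp: mult_ac)
    then show ?thesis
      by (simp only: pair_comult_scale_right) (simp add: dual_mult_def mult_ac)
  qed
  have h3: "pair_comult (\<lambda>x1 x2. a x1 * a' x2 * r) x = dual_mult a a' x * r" for x r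
  proof -
    have "pair_comult (\<lambda>x1 x2. a x1 * a' x2 * r) x = pair_comult (\<lambda>x1 x2. r * (a x1 * a' x2)) x"
      by (rule arg_cong[where f = "\<lambda>\<beta>. pair_comult \<beta> x"]) (auto intro!: ext simp: mult_ac)
    then show ?thesis
      by (simp only: pair_comult_scale_right) (simp add: dual_mult_def mult_ac)
  qed
  show "mult3 (pure3 a b c) (pure3 a' b' c') X =
      pure3 (dual_mult a a') (dual_mult b b') (dual_mult c c') X"
    by (cases X) (simp add: mult3_def pure3_def h1 h2 h3; simp add: mult.assoc)
qed

lemma comult_pure:
  "comult1 (pure3 a b c) (x, y, z, w) = dual_comult a (x, y) * b z * c w"
  "comult2 (pure3 a b c) (x, y, z, w) = a x * dual_comult b (y, z) * c w"
  "comult3 (pure3 a b c) (x, y, z, w) = a x * b y * dual_comult c (z, w)"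
  by (simp_all add: comult1_def comult2_def comult3_def dual_comult_def pure3_def)

lemma counit_pure:
  "counit1 (pure3 a b c) = fscale (dual_counit a) (pure2 b c)"
  "counit2 (pure3 a b c) = fscale (dual_counit b) (pure2 a c)"
  "counit3 (pure3 a b c) = fscale (dual_counit c) (pure2 a b)"
  by (auto simp: counit1_def counit2_def counit3_def dual_counit_def pure3_def pure2_def fscale_def)

lemma tensor_one_pure:
  "tensor_one_left (pure3 a b c) = pure4 dual_one a b c"
  "tensor_one_right (pure3 a b c) = pure4 a b c dual_one"
  by (auto simp: tensor_one_left_def tensor_one_right_def pure3_def pure4_def)


subsection \<open>Associators, additive cocycles and the exponential homomorphism\<close>

definition associator :: "('g, 'k) form3 \<Rightarrow> bool" where
  "associator \<Phi> \<longleftrightarrow>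
     \<Phi> \<in> tensor3 dual \<and>
     (\<exists>\<Psi>\<in>tensor3 dual. mult3 \<Phi> \<Psi> = one3 \<and> mult3 \<Psi> \<Phi> = one3) \<and>
     mult4 (comult3 \<Phi>) (comult1 \<Phi>) =
       mult4 (mult4 (tensor_one_left \<Phi>) (comult2 \<Phi>)) (tensor_one_right \<Phi>) \<and>
     counit1 \<Phi> = one2 \<and> counit2 \<Phi> = one2 \<and> counit3 \<Phi> = one2"

text \<open>The normalized additive cocycles \<open>Z\<^sup>3(\<Gamma>, \<G>\<^sub>a)\<close> of the group scheme \<open>\<Gamma>\<close> with coordinate
  Hopf algebra \<open>dual\<close>.\<close>

definition cocycles3 :: "('g, 'k) form3 set" where
  "cocycles3 = {\<phi> \<in> tensor3 aug_ideal.
     comult3 \<phi> + comult1 \<phi> = tensor_one_left \<phi> + comult2 \<phi> + tensor_one_right \<phi>}"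

text \<open>Homomorphisms of algebraic groups from the additive group of \<open>I \<otimes> I \<otimes> I\<close> to the multiplicative
  group \<open>1 + I \<otimes> I \<otimes> I\<close>.  The ground field being algebraically closed, these are the regular
  maps on points that are group homomorphisms.  Being extensional makes them determined by
  their values on \<open>I \<otimes> I \<otimes> I\<close>.\<close>

definition unipotent_hom :: "(('g, 'k) form3 \<Rightarrow> ('g, 'k) form3) \<Rightarrow> bool" where
  "unipotent_hom E \<longleftrightarrow>
     E \<in> extensional (tensor3 aug_ideal) \<and>
     E ` tensor3 aug_ideal \<subseteq> {one3 + \<tau> |\<tau>. \<tau> \<in> tensor3 aug_ideal} \<and>
     regular_map_on (tensor3 aug_ideal) E \<and>
     (\<forall>\<phi>\<in>tensor3 aug_ideal. \<forall>\<psi>\<in>tensor3 aug_ideal. E (\<phi> + \<psi>) = mult3 (E \<phi>) (E \<psi>))"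

definition truncated_exp :: "('g, 'k) form3 \<Rightarrow> ('g, 'k) form3" where
  "truncated_exp T = (\<Sum>j<p. fscale (inverse (of_nat (fact j))) (power3 T j))"

definition exp_hom :: "('g, 'k) form3 \<Rightarrow> ('g, 'k) form3" where
  "exp_hom = (THE E. unipotent_hom E \<and>
     (\<forall>a\<in>aug_ideal. \<forall>b\<in>aug_ideal. \<forall>c\<in>aug_ideal. E (pure3 a b c) = truncated_exp (pure3 a b c)))"

end

end

theory Submission
  imports Defs
begin

text \<open>A linear form on the restricted enveloping algebra is a function on words that respects the
  relators, and the product of the dual becomes the shuffle product.  On the shuffle algebra
  \<open>f \<mapsto> (w \<mapsto> f (x w))\<close> is a derivation for each letter \<open>x\<close>; a function on words is determined by its
  value at the empty word and its derivatives.  Hence \<open>f\<^sup>p\<close> vanishes if \<open>f\<close> has no constant term, and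
  there is an exponential characterised by \<open>E(\<phi>)([]) = 1\<close> and \<open>\<partial>\<^sub>x E(\<phi>) = \<partial>\<^sub>x \<phi> E(\<phi>)\<close>, with respect to
  the first tensor factor.  It is a homomorphism, natural in the coefficient ring, injective on
  functions without constant term, and agrees with the truncated exponential on decomposable
  tensors of the augmentation ideal.  Deconcatenation \<open>\<Delta>\<close> in the first factor satisfies
  \<open>\<Delta> E(\<phi>) = E(\<Delta> \<phi>) (1 \<otimes> E(\<phi>))\<close>, so the pentagon equation for \<open>E(\<phi>)\<close> is the cocycle equation for
  \<open>\<phi>\<close>.  Finally \<open>E(\<phi>) = 1 + \<phi>\<close> up to longer words, and as words of bounded length span the
  restricted enveloping algebra, successive approximation shows that \<open>E\<close> is onto \<open>1 + I \<otimes> I \<otimes> I\<close>.\<close>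

section \<open>The shuffle algebra\<close>

text \<open>Pairs \<open>h\<close> with the coproduct of a word for which every letter is primitive:
  the sum runs over all splittings of the word into two complementary subsequences.\<close>

fun unshuffle_sum :: "('a list \<Rightarrow> 'a list \<Rightarrow> 'r::comm_monoid_add) \<Rightarrow> 'a list \<Rightarrow> 'r" where
  "unshuffle_sum h [] = h [] []"
| "unshuffle_sum h (x # w) =
     unshuffle_sum (\<lambda>u v. h (x # u) v) w + unshuffle_sum (\<lambda>u v. h u (x # v)) w"

lemma unshuffle_sum_add:
  "unshuffle_sum (\<lambda>u v. h u v + h' u v) w = unshuffle_sum h w + unshuffle_sum h' w"
  by (induction w arbitrary: h h') (simp_all add: algebra_simps)

lemma unshuffle_sum_additive:
  assumes "\<And>a b. \<theta> (a + b) = \<theta> a + \<theta> b"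
  shows "\<theta> (unshuffle_sum h w) = unshuffle_sum (\<lambda>u v. \<theta> (h u v)) w"
  by (induction w arbitrary: h) (simp_all add: assms)

text \<open>A type constructor, so that the coefficient ring may again be a shuffle algebra: nested
  three or four times it holds functions of three or four words, one word for each tensor
  factor.\<close>

typedef ('a, 'r) shuf = "UNIV :: ('a list \<Rightarrow> 'r) set"
  morphisms coef Shuf by simp

lemmas coef_Shuf [simp] = Shuf_inverse[OF UNIV_I]

lemma shuf_eqI: "(\<And>w. coef f w = coef g w) \<Longrightarrow> f = g"
  by (metis coef_inverse ext)

instantiation shuf :: (type, comm_ring_1) comm_ring_1
begin

definition "0 = Shuf (\<lambda>w. 0)"
definition "1 = Shuf (\<lambda>w. if w = [] then 1 else 0)"
definition "f + g = Shuf (\<lambda>w. coef f w + coef g w)"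
definition "f - g = Shuf (\<lambda>w. coef f w - coef g w)"
definition "- f = Shuf (\<lambda>w. - coef f w)"
definition "f * g = Shuf (unshuffle_sum (\<lambda>u v. coef f u * coef g v))"

instance
proof
  fix f g h :: "('a, 'b) shuf"
  have comm: "unshuffle_sum (\<lambda>u v. a u * b v) w = unshuffle_sum (\<lambda>u v. b u * a v) w"
    for a b :: "'a list \<Rightarrow> 'b" and w
    by (induction w arbitrary: a b) (simp_all add: algebra_simps)
  have distrib: "unshuffle_sum (\<lambda>u v. (a u + a' u) * b v) w =
      unshuffle_sum (\<lambda>u v. a u * b v) w + unshuffle_sum (\<lambda>u v. a' u * b v) w"
    for a a' b :: "'a list \<Rightarrow> 'b" and w
    by (simp add: distrib_right unshuffle_sum_add)
  have assoc: "unshuffle_sum (\<lambda>u v. unshuffle_sum (\<lambda>u v. a u * b v) u * c v) w =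
      unshuffle_sum (\<lambda>u v. a u * unshuffle_sum (\<lambda>u v. b u * c v) v) w"
    for a b c :: "'a list \<Rightarrow> 'b" and w
    by (induction w arbitrary: a b c)
      (simp_all add: distrib_left distrib_right unshuffle_sum_add add.assoc mult.assoc)
  have zero: "unshuffle_sum (\<lambda>u v. 0) w = (0::'b)" for w :: "'a list"
    by (induction w) simp_all
  have one: "unshuffle_sum (\<lambda>u v. (if u = [] then 1 else 0) * b v) w = b w"
    for b :: "'a list \<Rightarrow> 'b" and w
    by (induction w arbitrary: b) (simp_all add: zero)
  show "f * g * h = f * (g * h)"
    by (rule shuf_eqI) (simp add: times_shuf_def assoc)
  show "f * g = g * f"
    by (rule shuf_eqI) (simp add: times_shuf_def comm[of "coef f"])
  show "1 * f = f"
    by (rule shuf_eqI) (simp add: times_shuf_def one_shuf_def one)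
  show "(f + g) * h = f * h + g * h"
    by (rule shuf_eqI) (simp add: times_shuf_def plus_shuf_def distrib)
  show "f + g + h = f + (g + h)" "f + g = g + f"
    by (simp_all add: plus_shuf_def algebra_simps)
  show "0 + f = f" "- f + f = 0" "f - g = f + - g"
    by (rule shuf_eqI; simp add: plus_shuf_def zero_shuf_def uminus_shuf_def minus_shuf_def)+
  show "(0::('a, 'b) shuf) \<noteq> 1"
  proof
    assume "(0::('a, 'b) shuf) = 1"
    then have "coef (0::('a, 'b) shuf) [] = coef (1::('a, 'b) shuf) []"
      by simp
    then show False
      by (simp add: zero_shuf_def one_shuf_def)
  qed
qed

end

lemma coef_simps [simp]:
  "coef 0 w = 0" "coef (f + g) w = coef f w + coef g w"
  "coef (f - g) w = coef f w - coef g w" "coef (- f) w = - coef f w"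
  by (simp_all add: zero_shuf_def plus_shuf_def minus_shuf_def uminus_shuf_def)

lemma coef_one: "coef 1 w = (if w = [] then 1 else 0)"
  by (simp add: one_shuf_def)

lemma coef_mult: "coef (f * g) w = unshuffle_sum (\<lambda>u v. coef f u * coef g v) w"
  by (simp add: times_shuf_def)

lemma coef_mult_Nil [simp]: "coef (f * g) [] = coef f [] * coef g []"
  by (simp add: coef_mult)

section \<open>The derivations that strip a first letter, and the constants\<close>

definition der :: "'a \<Rightarrow> ('a, 'r) shuf \<Rightarrow> ('a, 'r) shuf" where
  "der x f = Shuf (\<lambda>w. coef f (x # w))"

lemma coef_der: "coef (der x f) w = coef f (x # w)"
  by (simp add: der_def)

lemma shuf_eq_derI:
  assumes "coef f [] = coef g []" "\<And>x. der x f = der x g"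
  shows "f = g"
proof (rule shuf_eqI)
  fix w show "coef f w = coef g w"
    by (cases w) (use assms in \<open>simp_all flip: coef_der\<close>)
qed

lemma der_simps [simp]:
  "der x 0 = 0" "der x 1 = 0" "der x (f + g) = der x f + der x g"
  "der x (f - g) = der x f - der x g" "der x (- f) = - der x f"
  by (rule shuf_eqI; simp add: coef_der coef_one)+

text \<open>The recursion of \<open>unshuffle_sum\<close> at the first letter is exactly the Leibniz
  rule.\<close>

lemma der_mult: "der x (f * g) = der x f * g + f * der x g"
  by (rule shuf_eqI) (simp add: coef_der coef_mult)

lemma coef_mult_Cons: "coef (f * g) (x # w) = coef (der x f * g) w + coef (f * der x g) w"
  by (simp add: der_mult flip: coef_der)

lemma der_sum: "der x (\<Sum>i\<in>S. f i) = (\<Sum>i\<in>S. der x (f i))"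
  by (induction S rule: infinite_finite_induct) simp_all

lemma der_power: "der x (f ^ n) = of_nat n * f ^ (n - 1) * der x f"
proof (induction n)
  case (Suc n)
  then show ?case
    by (cases n) (simp_all add: der_mult algebra_simps)
qed simp

definition shconst :: "'r::zero \<Rightarrow> ('a, 'r) shuf" where
  "shconst r = Shuf (\<lambda>w. if w = [] then r else 0)"

lemma coef_shconst: "coef (shconst r) w = (if w = [] then r else 0)"
  by (simp add: shconst_def)

lemma der_shconst [simp]: "der x (shconst r :: ('a, 'r::comm_ring_1) shuf) = 0"
  by (rule shuf_eqI) (simp add: coef_der coef_shconst)

lemma shconst_simps:
  "shconst (r + s) = (shconst r + shconst s :: ('a, 'r::comm_ring_1) shuf)"
  "shconst (r * s) = (shconst r * shconst s :: ('a, 'r::comm_ring_1) shuf)"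
  "shconst 1 = (1 :: ('a, 'r::comm_ring_1) shuf)"
  "shconst 0 = (0 :: ('a, 'r::comm_ring_1) shuf)"
  by (rule shuf_eq_derI; simp add: coef_shconst coef_one der_mult)+

lemma shconst_power: "shconst (r ^ n) = (shconst r ^ n :: ('a, 'r::comm_ring_1) shuf)"
  by (induction n) (simp_all add: shconst_simps)

lemma coef_shconst_mult: "coef (shconst r * f) w = r * coef f w"
  by (induction w arbitrary: f) (simp_all add: coef_mult_Cons coef_shconst coef_der)

lemma coef_mult_shconst: "coef (f * shconst r) w = coef f w * r"
  by (simp add: mult.commute[of _ "shconst r"] coef_shconst_mult mult.commute[of r])

lemma der_eq_0_imp_shconst:
  assumes "\<And>x. der x f = 0"
  shows "f = shconst (coef f [])"
  by (rule shuf_eq_derI) (simp_all add: assms coef_shconst)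

lemma of_nat_shuf: "(of_nat n :: ('a, 'r::comm_ring_1) shuf) = shconst (of_nat n)"
  by (induction n) (simp_all add: shconst_simps)

text \<open>Each derivative of \<open>f ^ p\<close> carries the factor \<open>of_nat p\<close>, and
  the constant term is \<open>0 ^ p\<close>.\<close>

lemma power_char_eq_0:
  fixes f :: "('a, 'r::comm_ring_1) shuf"
  assumes "of_nat p = (0::'r)" "p > 0" "coef f [] = 0"
  shows "f ^ p = 0"
proof (rule shuf_eq_derI)
  have "coef (f ^ n) [] = coef f [] ^ n" for n
    by (induction n) (simp_all add: coef_one)
  then show "coef (f ^ p) [] = coef 0 []"
    using assms by (simp add: zero_power)
  show "der x (f ^ p) = der x 0" for x
    by (simp add: der_power of_nat_shuf assms shconst_simps)
qed


section \<open>Functoriality and deconcatenation\<close>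

definition ring_map :: "('r::comm_ring_1 \<Rightarrow> 's::comm_ring_1) \<Rightarrow> bool" where
  "ring_map \<theta> \<longleftrightarrow> \<theta> 1 = 1 \<and> (\<forall>a b. \<theta> (a + b) = \<theta> a + \<theta> b) \<and> (\<forall>a b. \<theta> (a * b) = \<theta> a * \<theta> b)"

lemma ring_map_zero: "ring_map \<theta> \<Longrightarrow> \<theta> 0 = 0"
  unfolding ring_map_def by (metis add_cancel_right_right)

lemma ring_map_mult: "ring_map \<theta> \<Longrightarrow> \<theta> (a * b) = \<theta> a * \<theta> b"
  by (simp add: ring_map_def)

definition shmap :: "('r \<Rightarrow> 's) \<Rightarrow> ('a, 'r) shuf \<Rightarrow> ('a, 's) shuf" where
  "shmap \<theta> f = Shuf (\<lambda>w. \<theta> (coef f w))"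

lemma coef_shmap [simp]: "coef (shmap \<theta> f) w = \<theta> (coef f w)"
  by (simp add: shmap_def)

lemma der_shmap: "der x (shmap \<theta> f) = shmap \<theta> (der x f)"
  by (rule shuf_eqI) (simp add: coef_der)

lemma ring_map_shmap:
  assumes "ring_map \<theta>"
  shows "ring_map (shmap \<theta> :: ('a, 'r::comm_ring_1) shuf \<Rightarrow> ('a, 's::comm_ring_1) shuf)"
  unfolding ring_map_def
proof (intro conjI allI)
  have hom: "\<theta> 1 = 1" "\<theta> (a + b) = \<theta> a + \<theta> b" "\<theta> (a * b) = \<theta> a * \<theta> b" for a b
    using assms by (simp_all add: ring_map_def)
  show "shmap \<theta> 1 = 1"
    by (rule shuf_eqI) (simp add: coef_one hom ring_map_zero[OF assms])
  show "shmap \<theta> (f + g) = shmap \<theta> f + shmap \<theta> g" for f g :: "('a, 'r) shuf"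
    by (rule shuf_eqI) (simp add: hom)
  show "shmap \<theta> (f * g) = shmap \<theta> f * shmap \<theta> g" for f g :: "('a, 'r) shuf"
    by (rule shuf_eqI) (simp add: coef_mult unshuffle_sum_additive[of \<theta>] hom)
qed

text \<open>The coproduct dual to concatenation. The outer word is the first tensor factor, so the
  derivations act on that one.\<close>

definition deconc :: "('a, 'r) shuf \<Rightarrow> ('a, ('a, 'r) shuf) shuf" where
  "deconc f = Shuf (\<lambda>u. Shuf (\<lambda>v. coef f (u @ v)))"

lemma coef_deconc [simp]: "coef (coef (deconc f) u) v = coef f (u @ v)"
  by (simp add: deconc_def)

lemma coef_deconc_Nil [simp]: "coef (deconc f) [] = f"
  by (rule shuf_eqI) simp

lemma der_deconc: "der x (deconc f) = deconc (der x f)"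
  by (intro shuf_eqI) (simp add: coef_der)

lemma deconc_add: "deconc (f + g) = deconc f + deconc g"
  by (intro shuf_eqI) simp

text \<open>Compatibility of shuffle product and deconcatenation. Since \<open>deconc\<close>
  commutes with \<open>der x\<close>, induction on the outer word reduces it to the empty outer
  word, where \<open>deconc\<close> gives back its argument.\<close>

lemma ring_map_deconc:
  "ring_map (deconc :: ('a, 'r::comm_ring_1) shuf \<Rightarrow> ('a, ('a, 'r) shuf) shuf)"
  unfolding ring_map_def
proof (intro conjI allI)
  show "deconc 1 = (1 :: ('a, ('a, 'r) shuf) shuf)"
    by (intro shuf_eqI) (simp add: coef_one)
  show "deconc (f + g) = deconc f + deconc g" for f g :: "('a, 'r) shuf"
    by (rule deconc_add)
  have "coef (deconc (f * g)) u = coef (deconc f * deconc g) u" for f g :: "('a, 'r) shuf" and u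
  proof (induction u arbitrary: f g)
    case (Cons x u)
    have "coef (deconc (f * g)) (x # u) =
        coef (deconc (der x f * g)) u + coef (deconc (f * der x g)) u"
      by (simp add: der_deconc der_mult deconc_add flip: coef_der)
    then show ?case
      by (simp add: Cons coef_mult_Cons der_deconc)
  qed simp
  then show "deconc (f * g) = deconc f * deconc g" for f g :: "('a, 'r) shuf"
    by (rule shuf_eqI)
qed

lemma ring_map_shconst: "ring_map (shconst :: 'r::comm_ring_1 \<Rightarrow> ('a, 'r) shuf)"
  by (simp add: ring_map_def shconst_simps)


section \<open>The exponential of the shuffle algebra\<close>

text \<open>The intended value of \<open>exp_mult \<phi> g\<close> is \<open>exp \<phi> * g\<close>; carrying the factor \<open>g\<close> along makes the
  differential equation of the exponential a primitive recursion on words.\<close>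

primrec exp_mult :: "('a, 'r::comm_ring_1) shuf \<Rightarrow> 'a list \<Rightarrow> ('a, 'r) shuf \<Rightarrow> 'r" where
  "exp_mult \<phi> [] g = coef g []"
| "exp_mult \<phi> (x # w) g = exp_mult \<phi> w (der x g + der x \<phi> * g)"

definition shexp :: "('a, 'r::comm_ring_1) shuf \<Rightarrow> ('a, 'r) shuf" where
  "shexp \<phi> = Shuf (\<lambda>w. exp_mult \<phi> w 1)"

lemma exp_mult_add: "exp_mult \<phi> w (g + h) = exp_mult \<phi> w g + exp_mult \<phi> w h"
proof (induction w arbitrary: g h)
  case (Cons x w)
  have "exp_mult \<phi> (x # w) (g + h) =
      exp_mult \<phi> w ((der x g + der x \<phi> * g) + (der x h + der x \<phi> * h))"
    by (simp add: algebra_simps)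
  then show ?case
    by (simp only: Cons.IH[of "der x g + der x \<phi> * g"] exp_mult.simps)
qed simp

text \<open>The case \<open>g = 1\<close> confirms the intended meaning:
  \<open>shexp \<phi> * h\<close> has the coefficients \<open>exp_mult \<phi> w h\<close>. The
  recursion changes \<open>g\<close>, hence the general form.\<close>

lemma exp_mult_mult:
  "coef (Shuf (\<lambda>w. exp_mult \<phi> w g) * h) w = exp_mult \<phi> w (g * h)"
proof (induction w arbitrary: g h)
  case (Cons x w)
  have "der x (Shuf (\<lambda>w. exp_mult \<phi> w g)) = Shuf (\<lambda>w. exp_mult \<phi> w (der x g + der x \<phi> * g))"
    by (rule shuf_eqI) (simp add: coef_der)
  then have "coef (Shuf (\<lambda>w. exp_mult \<phi> w g) * h) (x # w) =
      exp_mult \<phi> w ((der x g + der x \<phi> * g) * h + g * der x h)"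
    by (simp add: coef_mult_Cons Cons flip: exp_mult_add)
  then show ?case
    by (simp add: der_mult algebra_simps)
qed simp

lemma der_shexp: "der x (shexp \<phi>) = der x \<phi> * shexp \<phi>"
proof (rule shuf_eqI)
  fix w
  have "coef (shexp \<phi> * der x \<phi>) w = exp_mult \<phi> w (der x \<phi>)"
    by (simp add: shexp_def exp_mult_mult)
  then show "coef (der x (shexp \<phi>)) w = coef (der x \<phi> * shexp \<phi>) w"
    by (simp add: shexp_def coef_der mult.commute)
qed

lemma coef_shexp_Nil [simp]: "coef (shexp \<phi>) [] = 1"
  by (simp add: shexp_def coef_one)

lemma shexp_uminus: "shexp \<phi> * shexp (- \<phi>) = 1"
  by (rule shuf_eq_derI) (simp_all add: coef_one der_mult der_shexp algebra_simps)

text \<open>Variation of constants: all derivatives of \<open>shexp (- \<phi>) * f\<close> vanish,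
  so this product is constant.\<close>

lemma shexp_unique_solution:
  assumes "\<And>x. der x f = der x \<phi> * f"
  shows "f = shexp \<phi> * shconst (coef f [])"
proof -
  have "shexp (- \<phi>) * f = shconst (coef (shexp (- \<phi>) * f) [])"
    by (rule der_eq_0_imp_shconst) (simp add: der_mult der_shexp assms algebra_simps)
  then have "shexp \<phi> * (shexp (- \<phi>) * f) = shexp \<phi> * shconst (coef f [])"
    by simp
  then show ?thesis
    by (simp add: shexp_uminus flip: mult.assoc)
qed

lemma shexp_eqI:
  assumes "coef f [] = 1" "\<And>x. der x f = der x \<phi> * f"
  shows "f = shexp \<phi>"
  using shexp_unique_solution[OF assms(2)] assms(1) by (simp add: shconst_simps)

lemma shexp_add: "shexp (\<phi> + \<psi>) = shexp \<phi> * shexp \<psi>"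
  by (rule shexp_eqI[symmetric]) (simp_all add: der_mult der_shexp algebra_simps)

lemma shexp_zero [simp]: "shexp 0 = 1"
  by (rule shexp_eqI[symmetric]) (simp_all add: coef_one)

text \<open>The logarithmic derivative recovers \<open>der x \<phi>\<close>, the exponential being a
  unit.\<close>

lemma shexp_eq_imp_der_eq:
  assumes "shexp \<phi> = shexp \<psi>"
  shows "der x \<phi> = der x \<psi>"
proof -
  have "der x \<phi> * shexp \<phi> = der x \<psi> * shexp \<phi>"
    by (metis assms der_shexp)
  then have "der x \<phi> * (shexp \<phi> * shexp (- \<phi>)) = der x \<psi> * (shexp \<phi> * shexp (- \<phi>))"
    by (simp only: flip: mult.assoc)
  then show ?thesis
    by (simp add: shexp_uminus)
qed

lemma shexp_shmap:
  assumes "ring_map \<theta>"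
  shows "shmap \<theta> (shexp \<phi>) = shexp (shmap \<theta> \<phi>)"
proof (rule shexp_eqI)
  show "coef (shmap \<theta> (shexp \<phi>)) [] = 1"
    using assms by (simp add: ring_map_def)
  show "der x (shmap \<theta> (shexp \<phi>)) = der x (shmap \<theta> \<phi>) * shmap \<theta> (shexp \<phi>)" for x
    by (simp add: der_shmap der_shexp ring_map_mult[OF ring_map_shmap[OF assms]])
qed

text \<open>\<open>deconc (shexp \<phi>)\<close> solves the differential equation of
  \<open>shexp (deconc \<phi>)\<close>, but its value at the empty outer word is
  \<open>shexp \<phi>\<close> and not 1; this initial value is the second factor.\<close>

lemma deconc_shexp: "deconc (shexp \<phi>) = shexp (deconc \<phi>) * shconst (shexp \<phi>)"
proof -
  have "der x (deconc (shexp \<phi>)) = der x (deconc \<phi>) * deconc (shexp \<phi>)" for x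
    by (simp add: der_deconc der_shexp ring_map_mult[OF ring_map_deconc])
  then show ?thesis
    using shexp_unique_solution by fastforce
qed

text \<open>Once a common factor is cancelled, both sides of the pentagon are exponentials, and the
  logarithmic derivative in the first word turns products into sums.\<close>

lemma shexp_pentagon_imp_cocycle:
  fixes f :: "('a, ('a, ('a, 'r::comm_ring_1) shuf) shuf) shuf"
  assumes Nil: "coef f [] = 0"
    and pentagon: "shmap (shmap deconc) (shexp f) * deconc (shexp f) =
      shconst (shexp f) * shmap deconc (shexp f) * shmap (shmap (shmap shconst)) (shexp f)"
  shows "shmap (shmap deconc) f + deconc f =
    shconst f + shmap deconc f + shmap (shmap (shmap shconst)) f"
proof -
  have maps: "ring_map (shmap deconc :: ('a, ('a, 'r) shuf) shuf \<Rightarrow> _)"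
    "ring_map (deconc :: ('a, ('a, 'r) shuf) shuf \<Rightarrow> _)"
    "ring_map (shmap (shmap shconst) :: ('a, ('a, 'r) shuf) shuf \<Rightarrow> ('a, ('a, ('a, 'r) shuf) shuf) shuf)"
    by (intro ring_map_shmap ring_map_deconc ring_map_shconst)+
  let ?l = "shmap (shmap deconc) f + deconc f"
  let ?r = "shmap deconc f + shmap (shmap (shmap shconst)) f"
  let ?c = "shconst (shexp f) :: ('a, ('a, ('a, ('a, 'r) shuf) shuf) shuf) shuf"
  have inv: "?c * shconst (shexp (- f)) = 1"
    by (simp add: shexp_uminus shconst_simps flip: shconst_simps(2))
  \<comment> \<open>On the left the factor \<open>?c\<close> comes from \<open>deconc_shexp\<close>;
    on the right it is \<open>1 \<otimes> shexp f\<close> itself.\<close>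
  have "shexp ?l * ?c = shexp ?r * ?c"
    using pentagon by (simp add: shexp_shmap maps deconc_shexp shexp_add mult_ac)
  then have "shexp ?l * (?c * shconst (shexp (- f))) = shexp ?r * (?c * shconst (shexp (- f)))"
    by (simp only: flip: mult.assoc)
  then have "shexp ?l = shexp ?r"
    by (simp add: inv)
  then have der: "der x ?l = der x ?r" for x
    by (rule shexp_eq_imp_der_eq)
  \<comment> \<open>Integration in the first word. As \<open>coef f [] = 0\<close>, the constant
    terms of \<open>?l\<close> and \<open>?r\<close> are \<open>f\<close> and 0, so the summand
    \<open>1 \<otimes> f\<close> returns as the constant of integration.\<close>
  have "?l = shconst f + ?r"
  proof (rule shuf_eq_derI)
    show "coef ?l [] = coef (shconst f + ?r) []"
      by (simp add: coef_shconst Nil maps[THEN ring_map_zero])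
    show "der x ?l = der x (shconst f + ?r)" for x
      using der[of x] by simp
  qed
  then show ?thesis
    by (simp add: add.assoc)
qed

text \<open>Differentiation in the first word does not touch a factor \<open>s\<close> in the other
  positions, so the product contains \<open>s ^ p\<close>.\<close>

lemma power_mult_der_eq_0:
  fixes f :: "('a, 'r::comm_ring_1) shuf"
  assumes "s ^ p = 0" "p > 0"
  shows "(f * shconst s) ^ (p - 1) * der x (f * shconst s) = 0"
proof -
  obtain q where q: "p = Suc q"
    using \<open>p > 0\<close> gr0_implies_Suc by blast
  have "(f * shconst s) ^ q * der x (f * shconst s) = f ^ q * der x f * shconst s ^ Suc q"
    by (simp add: der_mult power_mult_distrib mult_ac)
  also have "\<dots> = 0"
    using assms(1) by (simp add: q shconst_simps flip: shconst_power power_Suc)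
  finally show ?thesis
    by (simp add: q)
qed

text \<open>\<open>c j\<close> stands for the inverse of \<open>j!\<close>, available only for
  \<open>j < p\<close>. The truncated sum fails its differential equation just by a multiple of
  \<open>T ^ (p - 1) * der x T\<close>, which is 0.\<close>

lemma shexp_eq_truncated_exp:
  fixes T :: "('a, 'r::comm_ring_1) shuf" and c :: "nat \<Rightarrow> 'r"
  assumes "p > 0" and c0: "c 0 = 1" and c: "\<And>j. Suc j < p \<Longrightarrow> of_nat (Suc j) * c (Suc j) = c j"
    and T: "coef T [] = 0" "\<And>x. T ^ (p - 1) * der x T = 0"
  shows "(\<Sum>j<p. shconst (c j) * T ^ j) = shexp T"
proof (rule shexp_eqI)
  obtain q where q: "p = Suc q"
    using \<open>p > 0\<close> gr0_implies_Suc by blast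
  have "coef (\<Sum>j<m. shconst (c j) * T ^ j) [] = (if m = 0 then 0 else 1)" for m
    by (induction m) (auto simp: c0 coef_one coef_shconst T(1) gr0_conv_Suc)
  then show "coef (\<Sum>j<p. shconst (c j) * T ^ j) [] = 1"
    using \<open>p > 0\<close> by simp
  fix x
  have c': "shconst (c (Suc j)) * of_nat (Suc j) = (shconst (c j) :: ('a, 'r) shuf)" if "j < q" for j
    using c[of j] that q by (simp add: of_nat_shuf mult.commute flip: shconst_simps del: of_nat_Suc)
  have "der x (\<Sum>j<p. shconst (c j) * T ^ j) =
      (\<Sum>j<Suc q. shconst (c j) * (of_nat j * T ^ (j - 1) * der x T))"
    by (simp add: q der_sum der_mult der_power)
  also have "\<dots> = (\<Sum>j<q. shconst (c (Suc j)) * of_nat (Suc j) * T ^ j * der x T)"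
    by (subst sum.lessThan_Suc_shift) (simp add: mult.assoc)
  also have "\<dots> = (\<Sum>j<q. shconst (c j) * T ^ j * der x T)"
    by (intro sum.cong) (simp_all only: lessThan_iff c')
  also have "\<dots> = (\<Sum>j<q. shconst (c j) * T ^ j) * der x T + shconst (c q) * (T ^ q * der x T)"
    using T(2)[of x] q by (simp add: sum_distrib_right)
  also have "\<dots> = der x T * (\<Sum>j<p. shconst (c j) * T ^ j)"
    by (simp add: q algebra_simps)
  finally show "der x (\<Sum>j<p. shconst (c j) * T ^ j) = der x T * (\<Sum>j<p. shconst (c j) * T ^ j)" .
qed


section \<open>The filtration by word length\<close>

text \<open>The length is measured on the outer word only, that is, in the first tensor
  factor.\<close>

definition vanishes_below :: "nat \<Rightarrow> ('a, 'r::zero) shuf \<Rightarrow> bool" where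
  "vanishes_below n f \<longleftrightarrow> (\<forall>w. length w < n \<longrightarrow> coef f w = 0)"

lemma vanishes_below_Suc:
  "vanishes_below (Suc n) f \<longleftrightarrow> coef f [] = 0 \<and> (\<forall>x. vanishes_below n (der x f))"
  unfolding vanishes_below_def by (auto simp: coef_der All_less_Suc2 length_Suc_conv less_Suc_eq_0_disj)

lemma vanishes_below_add:
  fixes f :: "('a, 'r::comm_ring_1) shuf"
  shows "vanishes_below n f \<Longrightarrow> vanishes_below n g \<Longrightarrow> vanishes_below n (f + g)"
  by (simp add: vanishes_below_def)

lemma vanishes_below_mono: "vanishes_below n f \<Longrightarrow> m \<le> n \<Longrightarrow> vanishes_below m f"
  by (simp add: vanishes_below_def)

text \<open>By the Leibniz rule a derivative lowers at most one of the two bounds by one, just as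
  the word gets shorter by one.\<close>

lemma vanishes_below_mult:
  fixes f :: "('a, 'r::comm_ring_1) shuf"
  assumes "vanishes_below m f" "vanishes_below n g"
  shows "vanishes_below (m + n) (f * g)"
proof -
  have "coef (f * g) w = 0"
    if "vanishes_below m f" "vanishes_below n g" "length w < m + n" for f g :: "('a, 'r) shuf" and m n w
    using that
  proof (induction w arbitrary: f g m n)
    case Nil
    then show ?case
      by (auto simp: vanishes_below_def)
  next
    case (Cons x w)
    have "coef (der x f * g) w = 0"
    proof (cases m)
      case 0
      then show ?thesis
        using Cons.prems Cons.IH[of 0 "der x f" n g] by (simp add: vanishes_below_def)
    next
      case (Suc m')
      then show ?thesis
        using Cons.prems Cons.IH[of m' "der x f" n g] by (simp add: vanishes_below_Suc)
    qed
    moreover have "coef (f * der x g) w = 0"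
    proof (cases n)
      case 0
      then show ?thesis
        using Cons.prems Cons.IH[of m f 0 "der x g"] by (simp add: vanishes_below_def)
    next
      case (Suc n')
      then show ?thesis
        using Cons.prems Cons.IH[of m f n' "der x g"] by (simp add: vanishes_below_Suc)
    qed
    ultimately show ?case
      by (simp add: coef_mult_Cons)
  qed
  then show ?thesis
    using assms by (simp add: vanishes_below_def)
qed

text \<open>The derivatives are \<open>der x \<phi> * (shexp \<phi> - 1)\<close>, of order at least
  \<open>n + (n + 1)\<close>; this suffices even for \<open>n = 0\<close>.\<close>

lemma shexp_first_order:
  fixes \<phi> :: "('a, 'r::comm_ring_1) shuf"
  assumes "vanishes_below (Suc n) \<phi>"
  shows "vanishes_below (Suc (Suc n)) (shexp \<phi> - 1 - \<phi>)"
proof -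
  have d: "vanishes_below n (der x \<phi>)" and "coef \<phi> [] = 0" for x
    using assms by (simp_all add: vanishes_below_Suc)
  then have "vanishes_below n (der x (shexp \<phi> - 1))" for x
    using vanishes_below_mult[of n "der x \<phi>" 0 "shexp \<phi>"]
    by (simp add: der_shexp vanishes_below_def)
  then have "vanishes_below (Suc n) (shexp \<phi> - 1)"
    by (simp add: vanishes_below_Suc coef_one)
  then have "vanishes_below (n + Suc n) (der x \<phi> * (shexp \<phi> - 1))" for x
    using d vanishes_below_mult by blast
  then have "vanishes_below (Suc n) (der x \<phi> * (shexp \<phi> - 1))" for x
    by (rule vanishes_below_mono) simp
  then show ?thesis
    using \<open>coef \<phi> [] = 0\<close>
    by (subst vanishes_below_Suc) (simp add: coef_one der_shexp algebra_simps)
qed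

text \<open>One step of the successive approximation: dividing \<open>1 + \<phi>\<close> by
  \<open>shexp \<phi>\<close> raises the order by one, because
  \<open>(1 - \<phi>) * (1 + \<phi>) = 1 - \<phi> * \<phi>\<close>.\<close>

lemma shexp_correction:
  fixes \<phi> :: "('a, 'r::comm_ring_1) shuf"
  assumes "vanishes_below (Suc n) \<phi>"
  shows "vanishes_below (Suc (Suc n)) (shexp (- \<phi>) * (1 + \<phi>) - 1)"
proof -
  have "vanishes_below (Suc (Suc n)) (shexp (- \<phi>) - 1 - (- \<phi>))"
    using assms by (intro shexp_first_order) (simp add: vanishes_below_def)
  then have "vanishes_below (Suc (Suc n)) ((shexp (- \<phi>) - 1 + \<phi>) * (1 + \<phi>))"
    using vanishes_below_mult[of "Suc (Suc n)" _ 0 "1 + \<phi>"] by (simp add: vanishes_below_def)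
  moreover have "vanishes_below (Suc (Suc n)) (- \<phi> * \<phi>)"
    using vanishes_below_mult[OF assms assms] by (simp add: vanishes_below_def)
  ultimately have "vanishes_below (Suc (Suc n)) ((shexp (- \<phi>) - 1 + \<phi>) * (1 + \<phi>) + - \<phi> * \<phi>)"
    by (rule vanishes_below_add)
  then show ?thesis
    by (simp add: algebra_simps)
qed


section \<open>Polynomial dependence on parameters\<close>

definition function_subring :: "('x \<Rightarrow> 'r::comm_ring_1) set \<Rightarrow> bool" where
  "function_subring P \<longleftrightarrow> (\<lambda>_. 0) \<in> P \<and> (\<lambda>_. 1) \<in> P \<and>
     (\<forall>r\<in>P. \<forall>s\<in>P. (\<lambda>t. r t + s t) \<in> P) \<and> (\<forall>r\<in>P. \<forall>s\<in>P. (\<lambda>t. r t * s t) \<in> P)"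

text \<open>\<open>P\<close> is a ring of functions of a parameter. With \<open>P\<close> the
  polynomial functions, the iterated construction expresses regular dependence of a function of
  several words on the parameter.\<close>

definition coefficientwise :: "('x \<Rightarrow> 'r) set \<Rightarrow> ('x \<Rightarrow> ('a, 'r) shuf) set" where
  "coefficientwise P = {H. \<forall>w. (\<lambda>t. coef (H t) w) \<in> P}"

lemma coefficientwise_der: "H \<in> coefficientwise P \<Longrightarrow> (\<lambda>t. der x (H t)) \<in> coefficientwise P"
  by (simp add: coefficientwise_def coef_der)

lemma function_subring_coefficientwise:
  assumes "function_subring P"
  shows "function_subring (coefficientwise P :: ('x \<Rightarrow> ('a, 'r::comm_ring_1) shuf) set)"
proof -
  have zero: "(\<lambda>_. 0) \<in> P" and one: "(\<lambda>_. 1) \<in> P"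
    and add: "\<And>r s. r \<in> P \<Longrightarrow> s \<in> P \<Longrightarrow> (\<lambda>t. r t + s t) \<in> P"
    and mult: "\<And>r s. r \<in> P \<Longrightarrow> s \<in> P \<Longrightarrow> (\<lambda>t. r t * s t) \<in> P"
    using assms by (auto simp: function_subring_def)
  have "(\<lambda>t. coef (F t * G t) w) \<in> P"
    if "F \<in> coefficientwise P" "G \<in> coefficientwise P" for F G :: "'x \<Rightarrow> ('a, 'r) shuf" and w
    using that
  proof (induction w arbitrary: F G)
    case Nil
    then show ?case
      by (simp add: coefficientwise_def mult)
  next
    case (Cons x w)
    then show ?case
      by (simp add: coef_mult_Cons add coefficientwise_der)
  qed
  then show ?thesis
    by (auto simp: function_subring_def coefficientwise_def coef_one zero one add)
qed

text \<open>The recursion behind \<open>shexp\<close> uses only sums, products and derivatives, and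
  starts from the constant family 1.\<close>

lemma coefficientwise_shexp:
  assumes P: "function_subring P" and H: "H \<in> coefficientwise P"
  shows "(\<lambda>t. shexp (H t)) \<in> coefficientwise P"
proof -
  have *: "(\<lambda>_. 1) \<in> coefficientwise P"
    "\<And>r s. r \<in> coefficientwise P \<Longrightarrow> s \<in> coefficientwise P \<Longrightarrow> (\<lambda>t. r t + s t) \<in> coefficientwise P"
    "\<And>r s. r \<in> coefficientwise P \<Longrightarrow> s \<in> coefficientwise P \<Longrightarrow> (\<lambda>t. r t * s t) \<in> coefficientwise P"
    using function_subring_coefficientwise[OF P] by (auto simp: function_subring_def)
  have "(\<lambda>t. exp_mult (H t) w (G t)) \<in> P" if "G \<in> coefficientwise P" for G w
    using that
  proof (induction w arbitrary: G)
    case Nil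
    then show ?case
      by (simp add: coefficientwise_def)
  next
    case (Cons x w)
    then show ?case
      by (simp add: Cons.IH * coefficientwise_der H)
  qed
  from this[OF *(1)] show ?thesis
    by (simp add: coefficientwise_def shexp_def)
qed


section \<open>Linear functionals on monoid algebras\<close>

definition lin :: "('m \<Rightarrow> 'k::field) \<Rightarrow> ('m \<Rightarrow>\<^sub>0 'k) \<Rightarrow> 'k" where
  "lin f t = (\<Sum>m\<in>Poly_Mapping.keys t. Poly_Mapping.lookup t m * f m)"

lemma lin_superset:
  assumes "finite S" "Poly_Mapping.keys t \<subseteq> S"
  shows "lin f t = (\<Sum>m\<in>S. Poly_Mapping.lookup t m * f m)"
  unfolding lin_def using assms by (intro sum.mono_neutral_left) (auto simp: in_keys_iff)

lemma lin_add: "lin f (s + t) = lin f s + lin f t"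
proof -
  let ?S = "Poly_Mapping.keys s \<union> Poly_Mapping.keys t"
  have "Poly_Mapping.keys (s + t) \<subseteq> ?S"
    by (rule keys_add)
  then show ?thesis
    by (simp add: lin_superset[of ?S] lookup_add algebra_simps sum.distrib)
qed

lemma lin_zero [simp]: "lin f 0 = 0"
  by (simp add: lin_def)

lemma lin_zero_fun [simp]: "lin (\<lambda>m. 0) t = 0"
  by (simp add: lin_def)

lemma lin_diff: "lin f (s - t) = lin f s - lin f t"
  using lin_add[of f "s - t" t] by simp

lemma lin_sum: "lin f (\<Sum>i\<in>S. t i) = (\<Sum>i\<in>S. lin f (t i))"
  by (induction S rule: infinite_finite_induct) (simp_all add: lin_add)

lemma lin_single [simp]: "lin f (Poly_Mapping.single m c) = c * f m"
  by (cases "c = 0") (simp_all add: lin_def)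

lemma sum_singles:
  "t = (\<Sum>m\<in>Poly_Mapping.keys t. Poly_Mapping.single m (Poly_Mapping.lookup t m))"
proof (rule poly_mapping_eqI)
  fix m
  have "Poly_Mapping.lookup t m =
      (\<Sum>n\<in>Poly_Mapping.keys t. if m = n then Poly_Mapping.lookup t n else 0)"
    by (subst sum.delta') (auto simp: in_keys_iff)
  then show "Poly_Mapping.lookup t m = Poly_Mapping.lookup
      (\<Sum>m\<in>Poly_Mapping.keys t. Poly_Mapping.single m (Poly_Mapping.lookup t m)) m"
    by (simp add: lookup_sum lookup_single when_def eq_commute)
qed

lemma lin_mult:
  fixes s t :: "'m::monoid_add \<Rightarrow>\<^sub>0 'k::field"
  shows "lin f (s * t) = lin (\<lambda>m. lin (\<lambda>n. f (m + n)) t) s"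
proof -
  let ?K = Poly_Mapping.keys and ?L = Poly_Mapping.lookup
  have "s * t = (\<Sum>m\<in>?K s. Poly_Mapping.single m (?L s m)) * (\<Sum>n\<in>?K t. Poly_Mapping.single n (?L t n))"
    using sum_singles[of s] sum_singles[of t] by simp
  also have "\<dots> = (\<Sum>m\<in>?K s. \<Sum>n\<in>?K t. Poly_Mapping.single (m + n) (?L s m * ?L t n))"
    by (simp add: sum_product mult_single)
  also have "lin f \<dots> = (\<Sum>m\<in>?K s. ?L s m * (\<Sum>n\<in>?K t. ?L t n * f (m + n)))"
    by (simp add: lin_sum sum_distrib_left mult.assoc)
  finally show ?thesis
    by (simp add: lin_def)
qed

lemma lin_scalar_mult: "lin f (scalar c * t) = c * lin f t"
  by (simp add: scalar_def lin_mult)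

lemma lin_one: "lin f 1 = f 0"
  by (simp flip: single_one)

section \<open>Words and the coproduct of the free algebra\<close>

primrec letters :: "'a word \<Rightarrow> 'a list" where
  "letters (Word w) = w"

lemma Word_letters [simp]: "Word (letters w) = w"
  by (cases w) simp

lemma letters_plus [simp]: "letters (v + w) = letters v @ letters w"
  by (cases v; cases w) simp

lemma letters_zero [simp]: "letters 0 = []"
  by (simp add: zero_word_def)

lemma gen_power: "gen x ^ n = Poly_Mapping.single (Word (replicate n x)) 1"
  by (induction n) (simp_all add: gen_def mult_single zero_word_def flip: single_one)

text \<open>Every letter is primitive, so expanding the product sends the first letter to the left
  or to the right, as in \<open>unshuffle_sum\<close>.\<close>

lemma lin_comult_word:
  "lin h (comult_word (Word w)) = unshuffle_sum (\<lambda>u v. h (Word u, Word v)) w"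
proof (induction w arbitrary: h)
  case Nil
  then show ?case
    by (simp add: lin_one zero_prod_def zero_word_def)
next
  case (Cons x w)
  have "lin (\<lambda>n. h ((Word [x], 0) + n)) (comult_word (Word w)) =
      unshuffle_sum (\<lambda>u v. h (Word (x # u), Word v)) w"
    "lin (\<lambda>n. h ((0, Word [x]) + n)) (comult_word (Word w)) =
      unshuffle_sum (\<lambda>u v. h (Word u, Word (x # v))) w"
    by (simp_all only: Cons.IH) (simp_all add: zero_word_def)
  then show ?case
    by (simp add: distrib_right lin_add lin_mult)
qed

lemma lin_free_comult:
  "lin h (free_comult t) =
     lin (\<lambda>w. unshuffle_sum (\<lambda>u v. h (Word u, Word v)) (letters w)) t"
proof -
  have "lin h (comult_word w) = unshuffle_sum (\<lambda>u v. h (Word u, Word v)) (letters w)" for w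
    using lin_comult_word[of h "letters w"] by simp
  then show ?thesis
    by (simp add: free_comult_def lin_sum lin_scalar_mult) (simp add: lin_def)
qed

text \<open>A binomial theorem: the \<open>i\<close> copies of \<open>x\<close> that go to the left
  can be chosen in \<open>n choose i\<close> ways. It serves for the relator that equates
  \<open>pmap x\<close> with a \<open>p\<close>-th power.\<close>

lemma unshuffle_sum_replicate:
  fixes h :: "'a list \<Rightarrow> 'a list \<Rightarrow> 'r::comm_semiring_1"
  shows "unshuffle_sum h (replicate n x @ w) = (\<Sum>i\<le>n. of_nat (n choose i) *
    unshuffle_sum (\<lambda>u v. h (replicate i x @ u) (replicate (n - i) x @ v)) w)"
proof (induction n arbitrary: h)
  case (Suc n)
  define T where
    "T i j = unshuffle_sum (\<lambda>u v. h (replicate i x @ u) (replicate j x @ v)) w" for i j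
  have "unshuffle_sum h (replicate (Suc n) x @ w) =
      (\<Sum>i\<le>n. of_nat (n choose i) * T (Suc i) (n - i)) +
      (\<Sum>i\<le>n. of_nat (n choose i) * T i (Suc n - i))"
    by (simp add: Suc T_def Suc_diff_le)
  \<comment> \<open>The extra term at \<open>Suc n\<close> has coefficient 0; the index shift that
    it permits prepares Pascal's rule.\<close>
  also have "(\<Sum>i\<le>n. of_nat (n choose i) * T i (Suc n - i)) =
      (\<Sum>i\<le>Suc n. of_nat (n choose i) * T i (Suc n - i))"
    by (simp add: binomial_eq_0)
  also have "\<dots> = T 0 (Suc n) + (\<Sum>i\<le>n. of_nat (n choose Suc i) * T (Suc i) (n - i))"
    by (subst sum.atMost_Suc_shift) simp
  also have "(\<Sum>i\<le>n. of_nat (n choose i) * T (Suc i) (n - i)) + \<dots> =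
      T 0 (Suc n) + (\<Sum>i\<le>n. of_nat (Suc n choose Suc i) * T (Suc i) (n - i))"
    by (simp add: algebra_simps sum.distrib)
  also have "\<dots> = (\<Sum>i\<le>Suc n. of_nat (Suc n choose i) * T i (Suc n - i))"
    by (subst sum.atMost_Suc_shift) simp
  finally show ?case
    by (simp only: T_def)
qed simp

section \<open>Tensor cubes of function spaces and their regular functions\<close>

interpretation fs: vector_space fscale
  by (rule vector_space_fscale)

lemma pure3_zero: "pure3 (\<lambda>_. 0) b c = (0 :: _ \<Rightarrow> 'k::field)"
  by (auto simp: pure3_def fun_eq_iff)

lemma tensor3_pure: "a \<in> V \<Longrightarrow> b \<in> V \<Longrightarrow> c \<in> V \<Longrightarrow> pure3 a b c \<in> tensor3 V"
  unfolding tensor3_def fspan_def by (rule fs.span_base) blast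

lemma tensor3_closed:
  "0 \<in> tensor3 V" "F \<in> tensor3 V \<Longrightarrow> G \<in> tensor3 V \<Longrightarrow> F + G \<in> tensor3 V"
  "F \<in> tensor3 V \<Longrightarrow> fscale c F \<in> tensor3 V" "F \<in> tensor3 V \<Longrightarrow> - F \<in> tensor3 V"
  "F \<in> tensor3 V \<Longrightarrow> G \<in> tensor3 V \<Longrightarrow> F - G \<in> tensor3 V"
  unfolding tensor3_def fspan_def
  by (auto intro: fs.span_zero fs.span_add fs.span_scale fs.span_neg fs.span_diff)

lemma tensor3_sum: "(\<And>i. i \<in> S \<Longrightarrow> F i \<in> tensor3 V) \<Longrightarrow> (\<Sum>i\<in>S. F i) \<in> tensor3 V"
  by (induction S rule: infinite_finite_induct) (simp_all add: tensor3_closed)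

lemma tensor3_mono: "V \<subseteq> W \<Longrightarrow> tensor3 V \<subseteq> tensor3 W"
  unfolding tensor3_def fspan_def by (rule fs.span_mono) blast

text \<open>Scalars are absorbed into the first factor, which is why \<open>V\<close> is closed
  under \<open>fscale\<close>; the step then adds a plain pure tensor.\<close>

lemma tensor3_induct [consumes 2, case_names zero pure_add]:
  assumes "F \<in> tensor3 V" "\<forall>c. \<forall>a\<in>V. fscale c a \<in> V"
    and zero: "P 0"
    and pure_add: "\<And>a b c G. a \<in> V \<Longrightarrow> b \<in> V \<Longrightarrow> c \<in> V \<Longrightarrow> G \<in> tensor3 V \<Longrightarrow> P G \<Longrightarrow> P (pure3 a b c + G)"
  shows "P F"
proof -
  have "F \<in> tensor3 V \<and> P F"
    using assms(1) unfolding tensor3_def fspan_def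
  proof (induction rule: fs.span_induct_alt)
    case base
    then show ?case
      using zero fs.span_zero by (simp add: zero_fun_def)
  next
    case (step k X G)
    then obtain a b c where X: "X = pure3 a b c" and abc: "a \<in> V" "b \<in> V" "c \<in> V"
      by blast
    have eq: "fscale k X = pure3 (fscale k a) b c"
      by (auto simp: X pure3_def fscale_def mult.assoc)
    have "fscale k a \<in> V" and G: "G \<in> tensor3 V" "P G"
      using assms(2) abc step by (auto simp: tensor3_def fspan_def)
    then show ?case
      using pure_add[of "fscale k a" b c G] tensor3_pure[of "fscale k a" V b c] abc
        tensor3_closed(2)[of "pure3 (fscale k a) b c" V G]
      by (simp add: eq plus_fun_def flip: fspan_def tensor3_def)
  qed
  then show ?thesis ..
qed

lemma poly_functions_sum:
  "(\<And>i. i \<in> S \<Longrightarrow> r i \<in> poly_functions) \<Longrightarrow> (\<lambda>f. \<Sum>i\<in>S. r i f) \<in> poly_functions"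
  by (induction S rule: infinite_finite_induct) (auto intro: poly_functions.intros)

lemma poly_functions_lin:
  "(\<And>m. r m \<in> poly_functions) \<Longrightarrow> (\<lambda>f. lin (\<lambda>m. r m f) t) \<in> poly_functions"
  unfolding lin_def by (intro poly_functions_sum poly_functions.intros)

lemma function_subring_poly_functions: "function_subring poly_functions"
  by (auto simp: function_subring_def intro: poly_functions.intros)


context restricted_lie_algebra
begin

section \<open>Linear forms as functions on words\<close>

definition cls :: "'g list \<Rightarrow> ('g, 'k) residue_class" where
  "cls w = coset (Poly_Mapping.single (Word w) 1)"

text \<open>The functions on words that descend to the restricted enveloping algebra: the contexts
  \<open>u\<close> and \<open>v\<close> account for two-sided multiples of the relators.\<close>

definition invariant :: "('g list \<Rightarrow> 'k) \<Rightarrow> bool" where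
  "invariant f \<longleftrightarrow> (\<forall>r\<in>relators. \<forall>u v. lin (\<lambda>n. f (u @ letters n @ v)) r = 0)"

lemma invariant_iff:
  "invariant f \<longleftrightarrow>
     (\<forall>x y u v. f (u @ (x + y) # v) = f (u @ x # v) + f (u @ y # v)) \<and>
     (\<forall>c x u v. f (u @ scale c x # v) = c * f (u @ x # v)) \<and>
     (\<forall>x y u v. f (u @ br x y # v) = f (u @ x # y # v) - f (u @ y # x # v)) \<and>
     (\<forall>x u v. f (u @ pmap x # v) = f (u @ replicate p x @ v))"
proof -
  have split: "(\<forall>r\<in>relators. Q r) \<longleftrightarrow> (\<forall>x y. Q (gen (x + y) - (gen x + gen y))) \<and>
     (\<forall>c x. Q (gen (scale c x) - scalar c * gen x)) \<and>
     (\<forall>x y. Q (gen (br x y) - (gen x * gen y - gen y * gen x))) \<and>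
     (\<forall>x. Q (gen (pmap x) - gen x ^ p))" for Q
    unfolding relators_def by blast
  have gen: "lin g (gen x) = g (Word [x])" for g :: "'g word \<Rightarrow> 'k" and x
    by (simp add: gen_def)
  have "lin g (gen x * gen y) = g (Word [x, y])" "lin g (gen x ^ n) = g (Word (replicate n x))"
    for g :: "'g word \<Rightarrow> 'k" and x y n
    by (simp_all add: gen_power) (simp add: gen_def mult_single)
  then show ?thesis
    unfolding invariant_def split by (simp add: lin_diff lin_add lin_scalar_mult gen)
qed

lemma invariant_translate:
  assumes "invariant f"
  shows "invariant (\<lambda>w. f (u @ w))" "invariant (\<lambda>w. f (w @ u))"
proof -
  have *: "lin (\<lambda>n. f (u' @ letters n @ v')) r = 0" if "r \<in> relators" for r u' v'
    using assms that by (simp add: invariant_def)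
  show "invariant (\<lambda>w. f (u @ w))" "invariant (\<lambda>w. f (w @ u))"
    using *[of _ "u @ _"] *[of _ _ "_ @ u"] by (simp_all add: invariant_def)
qed

text \<open>A product with \<open>r\<close> translates \<open>f\<close>, and translates of invariant
  functions are invariant; hence \<open>f\<close> varies in the induction.\<close>

lemma lin_ideal_eq_0:
  assumes "t \<in> ideal_gen relators" "invariant f"
  shows "lin (\<lambda>w. f (letters w)) t = 0"
  using assms
proof (induction arbitrary: f)
  case (base r)
  then have "lin (\<lambda>n. f ([] @ letters n @ [])) r = 0"
    unfolding invariant_def by blast
  then show ?case
    by simp
next
  case (lmult s r)
  have "lin (\<lambda>n. f (letters (m + n))) s = 0" for m
    using lmult.IH[OF invariant_translate(1)[OF lmult.prems, of "letters m"]] by simp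
  then show ?case
    by (simp add: lin_mult)
next
  case (rmult s r)
  have "lin (\<lambda>n. f (letters (n + m))) s = 0" for m
    using rmult.IH[OF invariant_translate(2)[OF rmult.prems, of "letters m"]] by simp
  \<comment> \<open>The induction hypothesis fixes the right factor, so the sum over the words of
    \<open>r\<close> has to come outside.\<close>
  then have "lin (\<lambda>n. lin (\<lambda>m. f (letters (n + m))) r) s = 0"
    unfolding lin_def sum_distrib_left by (subst sum.swap) (simp add: mult.left_commute flip: sum_distrib_left)
  then show ?case
    by (simp add: lin_mult)
qed (simp_all add: lin_add)

lemma dual_coset:
  assumes "f \<in> dual"
  shows "f (coset t) = lin (\<lambda>w. f (cls (letters w))) t"
proof -
  have add: "f (coset (s + t)) = f (coset s) + f (coset t)"
    and scal: "f (coset (scalar c * t)) = c * f (coset t)" for s t c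
    using assms by (simp_all add: dual_def)
  have zero: "f (coset 0) = 0"
    using scal[of 0 0] by simp
  have "f (coset (\<Sum>m\<in>S. Poly_Mapping.single m (a m))) = (\<Sum>m\<in>S. a m * f (cls (letters m)))" for S a
  proof (induction S rule: infinite_finite_induct)
    case (insert m S)
    have "Poly_Mapping.single m (a m) = scalar (a m) * Poly_Mapping.single m 1"
      by (simp add: scalar_def mult_single)
    then have "f (coset (Poly_Mapping.single m (a m))) = a m * f (cls (letters m))"
      by (simp add: scal cls_def)
    with insert show ?case
      by (simp add: add)
  qed (simp_all add: zero)
  then show ?thesis
    unfolding lin_def using sum_singles[of t] by metis
qed

lemma dual_outside: "f \<in> dual \<Longrightarrow> X \<notin> uea \<Longrightarrow> f X = 0"
  by (simp add: dual_def)

lemma dual_eqI: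
  assumes "f \<in> dual" "g \<in> dual" "\<And>w. f (cls w) = g (cls w)"
  shows "f = g"
proof
  fix X
  show "f X = g X"
  proof (cases "X \<in> uea")
    case True
    then obtain t where "X = coset t"
      by (auto simp: uea_def)
    then show ?thesis
      using assms by (simp add: dual_coset)
  qed (simp add: dual_outside assms)
qed

lemma dual_invariant:
  assumes "f \<in> dual"
  shows "invariant (\<lambda>w. f (cls w))"
  unfolding invariant_def
proof (intro ballI allI)
  fix r u v assume "r \<in> relators"
  let ?t = "Poly_Mapping.single (Word u) 1 * r * Poly_Mapping.single (Word v) 1"
  have "?t \<in> ideal_gen relators"
    by (intro ideal_gen.lmult ideal_gen.rmult ideal_gen.base) fact
  then have "coset ?t = coset 0"
    by (simp add: coset_eq_iff)
  then have "f (coset ?t) = 0"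
    using dual_coset[OF assms, of 0] by simp
  then show "lin (\<lambda>n. f (cls (u @ letters n @ v))) r = 0"
    by (simp add: dual_coset[OF assms] lin_mult)
qed

text \<open>Invariance makes the value at a representative independent of the choice. The equation
  for \<open>f\<close> has the shape of \<open>pair_comult_eq\<close> and
  \<open>uea_counit_eq\<close>, so both operations are covered.\<close>

lemma dual_of_invariant:
  assumes "invariant g" and f: "f = (\<lambda>X. if X \<in> uea then lin (\<lambda>w. g (letters w)) (rep X) else 0)"
  shows "f \<in> dual" "f (cls w) = g w"
proof -
  have *: "f (coset t) = lin (\<lambda>w. g (letters w)) t" for t
    using lin_ideal_eq_0[OF rep_coset \<open>invariant g\<close>, of t] by (simp add: f uea_def lin_diff)
  then show "f \<in> dual"
    by (simp add: dual_def lin_add lin_scalar_mult) (simp add: f)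
  show "f (cls w) = g w"
    by (simp add: cls_def *)
qed

lemma dual_closed:
  assumes "f \<in> dual"
  shows "(\<lambda>x. f x * c) \<in> dual" "(\<lambda>x. c * f x) \<in> dual" "fscale c f \<in> dual"
  using assms by (auto simp: dual_def fscale_def algebra_simps)

lemma dual_add: "f \<in> dual \<Longrightarrow> g \<in> dual \<Longrightarrow> (\<lambda>x. f x + g x) \<in> dual"
  by (auto simp: dual_def algebra_simps)

lemma dual_zero: "(\<lambda>x. 0) \<in> dual"
  by (simp add: dual_def)

lemma dual_sum: "(\<And>i. i \<in> S \<Longrightarrow> f i \<in> dual) \<Longrightarrow> (\<lambda>x. \<Sum>i\<in>S. f i x) \<in> dual"
  by (induction S rule: infinite_finite_induct) (auto simp: dual_zero dual_add)

lemma prime_char: "prime p"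
  using prime_CHAR_semidom[where 'a = 'k] char_eq char_pos by simp

lemma of_nat_char [simp]: "of_nat p = (0::'k)"
  using of_nat_CHAR[where 'a = 'k] char_eq by simp

text \<open>This is where the ideal generated by the relators is seen to be a coideal: the \<open>p\<close>-th power
  of a primitive element is primitive, because the inner binomial coefficients vanish.\<close>

lemma invariant_unshuffle_sum:
  assumes "\<And>v. invariant (\<lambda>u. h u v)" "\<And>u. invariant (h u)"
  shows "invariant (unshuffle_sum h)"
proof -
  \<comment> \<open>Invariance in both variables passes to \<open>h\<close> with a letter attached
    on either side, so the inductions over \<open>u\<close> let \<open>h\<close> vary.\<close>
  define bi where "bi h \<longleftrightarrow> (\<forall>v. invariant (\<lambda>u. h u v)) \<and> (\<forall>u. invariant (h u))" for h
  have step: "bi (\<lambda>u v. h (x # u) v)" "bi (\<lambda>u v. h u (x # v))" if "bi h" for h x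
    using that invariant_translate(1)[of "\<lambda>u. h u _" "[x]"] invariant_translate(1)[of "h _" "[x]"]
    by (simp_all add: bi_def)
  have left: "h ((x + y) # u) = (\<lambda>v. h (x # u) v + h (y # u) v)"
    "h (scale c x # u) = (\<lambda>v. c * h (x # u) v)"
    "h (br x y # u) = (\<lambda>v. h (x # y # u) v - h (y # x # u) v)"
    "h (pmap x # u) = h (replicate p x @ u)"
    and right: "h u ((x + y) # v) = h u (x # v) + h u (y # v)"
    "h u (scale c x # v) = c * h u (x # v)"
    "h u (br x y # v) = h u (x # y # v) - h u (y # x # v)"
    "h u (pmap x # v) = h u (replicate p x @ v)" if "bi h" for h x y c u v
    using that unfolding bi_def invariant_iff fun_eq_iff by (metis append_Nil)+
  have scal: "unshuffle_sum (\<lambda>u v. c * h u v) w = c * unshuffle_sum h w" for c :: 'k and h and w :: "'g list"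
    by (rule unshuffle_sum_additive[symmetric]) (simp add: distrib_left)
  have diff: "unshuffle_sum (\<lambda>u v. h u v - h' u v) w = unshuffle_sum h w - unshuffle_sum h' w"
    for h h' :: "'g list \<Rightarrow> 'g list \<Rightarrow> 'k" and w
    using unshuffle_sum_add[of "\<lambda>u v. h u v - h' u v" h' w] by simp
  have "unshuffle_sum h (u @ (x + y) # v) = unshuffle_sum h (u @ x # v) + unshuffle_sum h (u @ y # v)"
    if "bi h" for h u v x y
    using that
    by (induction u arbitrary: h) (simp_all add: left right unshuffle_sum_add step)
  moreover have "unshuffle_sum h (u @ scale c x # v) = c * unshuffle_sum h (u @ x # v)"
    if "bi h" for h u v c x
    using that by (induction u arbitrary: h) (simp_all add: left right scal step algebra_simps)
  moreover have "unshuffle_sum h (u @ br x y # v) =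
      unshuffle_sum h (u @ x # y # v) - unshuffle_sum h (u @ y # x # v)" if "bi h" for h u v x y
    using that by (induction u arbitrary: h) (simp_all add: left right diff step)
  moreover have "unshuffle_sum h (u @ pmap x # v) = unshuffle_sum h (u @ replicate p x @ v)"
    if "bi h" for h u v x
    using that
  proof (induction u arbitrary: h)
    case Nil
    let ?T = "\<lambda>i. unshuffle_sum (\<lambda>u v. h (replicate i x @ u) (replicate (p - i) x @ v)) v"
    have "of_nat (p choose i) = (0::'k)" if "i \<in> {..p} - {0, p}" for i
      using dvd_choose_prime[of i p] prime_char that char_eq of_nat_eq_0_iff_char_dvd[where 'a = 'k]
      by auto
    then have "(\<Sum>i\<le>p. of_nat (p choose i) * ?T i) = (\<Sum>i\<in>{0, p}. of_nat (p choose i) * ?T i)"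
      by (intro sum.mono_neutral_right) auto
    then show ?case
      using Nil char_pos by (simp add: unshuffle_sum_replicate left right)
  qed (simp_all add: step)
  moreover have "bi h"
    using assms by (simp add: bi_def)
  ultimately show ?thesis
    unfolding invariant_iff by simp
qed

section \<open>Product, counit and coproduct of the dual in terms of words\<close>

lemma pair_comult_eq:
  "pair_comult \<beta> = (\<lambda>X. if X \<in> uea
     then lin (\<lambda>w. unshuffle_sum (\<lambda>u v. \<beta> (cls u) (cls v)) (letters w)) (rep X) else 0)"
proof
  fix X
  let ?h = "\<lambda>(v, w). \<beta> (coset (Poly_Mapping.single v 1)) (coset (Poly_Mapping.single w 1))"
  have "pair_comult \<beta> X = (if X \<in> uea then lin ?h (free_comult (rep X)) else 0)"
    by (simp add: pair_comult_def lin_def case_prod_beta)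
  then show "pair_comult \<beta> X = (if X \<in> uea
     then lin (\<lambda>w. unshuffle_sum (\<lambda>u v. \<beta> (cls u) (cls v)) (letters w)) (rep X) else 0)"
    by (simp add: lin_free_comult cls_def)
qed

lemma
  assumes "\<And>y. (\<lambda>x. \<beta> x y) \<in> dual" "\<And>x. \<beta> x \<in> dual"
  shows pair_comult_dual: "pair_comult \<beta> \<in> dual"
    and pair_comult_cls: "pair_comult \<beta> (cls w) = unshuffle_sum (\<lambda>u v. \<beta> (cls u) (cls v)) w"
proof -
  have "invariant (unshuffle_sum (\<lambda>u v. \<beta> (cls u) (cls v)))"
    by (intro invariant_unshuffle_sum dual_invariant[where f = "\<lambda>x. \<beta> x _"] dual_invariant assms)
  from dual_of_invariant[OF this pair_comult_eq]
  show "pair_comult \<beta> \<in> dual" "pair_comult \<beta> (cls w) = unshuffle_sum (\<lambda>u v. \<beta> (cls u) (cls v)) w"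
    by blast+
qed

text \<open>For nested pairings as in \<open>mult3\<close>: linearity in a variable that the pairing
  at hand only carries along.\<close>

lemma pair_comult_parameter:
  assumes "\<And>a b. (\<lambda>x. \<beta> x a b) \<in> dual"
  shows "(\<lambda>x. pair_comult (\<beta> x) z) \<in> dual"
  by (cases "z \<in> uea")
    (auto simp: pair_comult_def case_prod_beta dual_zero assms intro!: dual_sum dual_closed)

lemma counit_invariant: "invariant (\<lambda>w. if w = [] then 1 else 0)"
  using char_pos by (simp add: invariant_iff)

lemma uea_counit_eq:
  "uea_counit = (\<lambda>X. if X \<in> uea then lin (\<lambda>w. if letters w = [] then 1 else 0) (rep X) else 0)"
proof
  fix X
  have "lin (\<lambda>w. if letters w = [] then 1 else 0) t = Poly_Mapping.lookup t 0" for t :: "('g, 'k) free_algebra"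
  proof -
    have "letters w = [] \<longleftrightarrow> w = 0" for w :: "'g word"
      by (cases w) (simp add: zero_word_def)
    then have "lin (\<lambda>w. if letters w = [] then 1 else 0) t =
        (\<Sum>w\<in>Poly_Mapping.keys t. if w = 0 then Poly_Mapping.lookup t w else 0)"
      by (simp add: lin_def if_distrib cong: if_cong)
    also have "\<dots> = Poly_Mapping.lookup t 0"
      by (subst sum.delta) (auto simp: in_keys_iff)
    finally show ?thesis .
  qed
  then show "uea_counit X =
      (if X \<in> uea then lin (\<lambda>w. if letters w = [] then 1 else 0) (rep X) else 0)"
    by (simp add: uea_counit_def)
qed

lemma counit_dual: "uea_counit \<in> dual"
  and counit_cls: "uea_counit (cls w) = (if w = [] then 1 else 0)"
  using dual_of_invariant[OF counit_invariant uea_counit_eq] by simp_all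

lemma uea_one_eq: "uea_one = cls []"
  by (simp add: uea_one_def cls_def flip: zero_word_def single_one)

lemma uea_mult_cls: "uea_mult (cls u) (cls v) = cls (u @ v)"
  by (simp add: cls_def uea_mult_coset mult_single)

lemma cls_uea [simp]: "cls w \<in> uea"
  by (simp add: cls_def uea_def)

lemma dual_uea_mult:
  assumes "f \<in> dual"
  shows "(\<lambda>x. if x \<in> uea \<and> y \<in> uea then f (uea_mult x y) else 0) \<in> dual" (is "?L \<in> dual")
    and "(\<lambda>x. if y \<in> uea \<and> x \<in> uea then f (uea_mult y x) else 0) \<in> dual" (is "?R \<in> dual")
proof -
  have add: "f (coset (s + t)) = f (coset s) + f (coset t)"
    and scal: "f (coset (scalar c * t)) = c * f (coset t)" for s t c
    using assms by (simp_all add: dual_def)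
  \<comment> \<open>Scalars in the right-hand factor can be moved to the front, which gives
    homogeneity in that factor too.\<close>
  have central: "s * (scalar c * t) = scalar c * (s * t)" for s t :: "('g, 'k) free_algebra" and c
  proof -
    have "s * scalar c = scalar c * s"
      unfolding scalar_def by (subst (1 2) sum_singles[of s]) (simp add: sum_distrib_left sum_distrib_right mult_single mult.commute)
    then show ?thesis
      by (simp flip: mult.assoc)
  qed
  have "?L \<in> dual \<and> ?R \<in> dual"
  proof (cases "y \<in> uea")
    case True
    then obtain t where y: "y = coset t"
      by (auto simp: uea_def)
    have in_uea: "coset s \<in> uea" for s
      by (simp add: uea_def)
    show ?thesis
      unfolding dual_def y
      by (auto simp: in_uea uea_mult_coset distrib_left distrib_right add mult.assoc central scal)
  qed (simp add: dual_zero)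
  then show "?L \<in> dual" "?R \<in> dual"
    by blast+
qed


section \<open>Multilinear forms and the shuffle algebra\<close>

text \<open>Unlike membership in \<open>tensor3 dual\<close>, this is checked one argument at a
  time, and it still makes a form determined by its values at words.\<close>

definition multilinear3 :: "('g, 'k) form3 \<Rightarrow> bool" where
  "multilinear3 F \<longleftrightarrow> (\<forall>y z. (\<lambda>x. F (x, y, z)) \<in> dual) \<and>
     (\<forall>x z. (\<lambda>y. F (x, y, z)) \<in> dual) \<and> (\<forall>x y. (\<lambda>z. F (x, y, z)) \<in> dual)"

definition multilinear4 :: "('g, 'k) form4 \<Rightarrow> bool" where
  "multilinear4 F \<longleftrightarrow> (\<forall>y z w. (\<lambda>x. F (x, y, z, w)) \<in> dual) \<and>
     (\<forall>x z w. (\<lambda>y. F (x, y, z, w)) \<in> dual) \<and> (\<forall>x y w. (\<lambda>z. F (x, y, z, w)) \<in> dual) \<and>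
     (\<forall>x y z. (\<lambda>w. F (x, y, z, w)) \<in> dual)"

lemma multilinear3D:
  assumes "multilinear3 F"
  shows "(\<lambda>x. F (x, y, z)) \<in> dual" "(\<lambda>y. F (x, y, z)) \<in> dual" "(\<lambda>z. F (x, y, z)) \<in> dual"
  using assms by (simp_all add: multilinear3_def)

lemma multilinear4D:
  assumes "multilinear4 F"
  shows "(\<lambda>x. F (x, y, z, w)) \<in> dual" "(\<lambda>y. F (x, y, z, w)) \<in> dual"
    "(\<lambda>z. F (x, y, z, w)) \<in> dual" "(\<lambda>w. F (x, y, z, w)) \<in> dual"
  using assms by (simp_all add: multilinear4_def)

text \<open>The first tensor factor becomes the outermost word, on which \<open>der\<close>,
  \<open>deconc\<close> and \<open>shexp\<close> act.\<close>

definition hat3 :: "('g, 'k) form3 \<Rightarrow> ('g, ('g, ('g, 'k) shuf) shuf) shuf" where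
  "hat3 F = Shuf (\<lambda>u. Shuf (\<lambda>v. Shuf (\<lambda>w. F (cls u, cls v, cls w))))"

definition hat4 :: "('g, 'k) form4 \<Rightarrow> ('g, ('g, ('g, ('g, 'k) shuf) shuf) shuf) shuf" where
  "hat4 F = Shuf (\<lambda>t. Shuf (\<lambda>u. Shuf (\<lambda>v. Shuf (\<lambda>w. F (cls t, cls u, cls v, cls w)))))"

lemma coef_hat3 [simp]: "coef (coef (coef (hat3 F) u) v) w = F (cls u, cls v, cls w)"
  by (simp add: hat3_def)

lemma coef_hat4 [simp]:
  "coef (coef (coef (coef (hat4 F) t) u) v) w = F (cls t, cls u, cls v, cls w)"
  by (simp add: hat4_def)

lemma hat3_inj:
  assumes "multilinear3 F" "multilinear3 G" "hat3 F = hat3 G"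
  shows "F = G"
proof -
  have 0: "F (cls u, cls v, cls w) = G (cls u, cls v, cls w)" for u v w
    using arg_cong[OF assms(3), of "\<lambda>f. coef (coef (coef f u) v) w"] by simp
  have 1: "F (cls u, cls v, z) = G (cls u, cls v, z)" for u v z
    using dual_eqI[OF assms(1,2)[THEN multilinear3D(3)], of "cls u" "cls v" "cls u" "cls v"] 0 by meson
  have 2: "F (cls u, y, z) = G (cls u, y, z)" for u y z
    using dual_eqI[OF assms(1,2)[THEN multilinear3D(2)], of "cls u" z "cls u" z] 1 by meson
  have "F (x, y, z) = G (x, y, z)" for x y z
    using dual_eqI[OF assms(1,2)[THEN multilinear3D(1)], of y z y z] 2 by meson
  then show ?thesis
    by auto
qed

lemma hat4_inj:
  assumes "multilinear4 F" "multilinear4 G" "hat4 F = hat4 G"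
  shows "F = G"
proof -
  have 0: "F (cls t, cls u, cls v, cls w) = G (cls t, cls u, cls v, cls w)" for t u v w
    using arg_cong[OF assms(3), of "\<lambda>f. coef (coef (coef (coef f t) u) v) w"] by simp
  have 1: "F (cls t, cls u, cls v, w) = G (cls t, cls u, cls v, w)" for t u v w
    using dual_eqI[OF assms(1,2)[THEN multilinear4D(4)], of "cls t" "cls u" "cls v" "cls t" "cls u" "cls v"] 0
    by meson
  have 2: "F (cls t, cls u, z, w) = G (cls t, cls u, z, w)" for t u z w
    using dual_eqI[OF assms(1,2)[THEN multilinear4D(3)], of "cls t" "cls u" w "cls t" "cls u" w] 1 by meson
  have 3: "F (cls t, y, z, w) = G (cls t, y, z, w)" for t y z w
    using dual_eqI[OF assms(1,2)[THEN multilinear4D(2)], of "cls t" z w "cls t" z w] 2 by meson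
  have "F (x, y, z, w) = G (x, y, z, w)" for x y z w
    using dual_eqI[OF assms(1,2)[THEN multilinear4D(1)], of y z w y z w] 3 by meson
  then show ?thesis
    by auto
qed

lemma multilinear3_closed:
  "multilinear3 0"
  "multilinear3 F \<Longrightarrow> multilinear3 G \<Longrightarrow> multilinear3 (F + G)"
  "multilinear3 F \<Longrightarrow> multilinear3 (fscale c F)"
  by (simp_all add: multilinear3_def fscale_def dual_zero dual_add dual_closed)

lemma multilinear3_pure:
  "a \<in> dual \<Longrightarrow> b \<in> dual \<Longrightarrow> c \<in> dual \<Longrightarrow> multilinear3 (pure3 a b c)"
  by (simp add: multilinear3_def pure3_def dual_closed mult.assoc)

lemma multilinear4_add:
  "multilinear4 F \<Longrightarrow> multilinear4 G \<Longrightarrow> multilinear4 (F + G)"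
  by (simp add: multilinear4_def dual_add)

lemma tensor3_dual_multilinear:
  assumes "F \<in> tensor3 dual"
  shows "multilinear3 F"
proof -
  have "\<forall>c. \<forall>a\<in>dual. fscale c a \<in> dual"
    by (simp add: dual_closed)
  with assms show ?thesis
    by (induction rule: tensor3_induct) (simp_all only: multilinear3_closed multilinear3_pure)
qed

lemma hat3_simps:
  "hat3 0 = 0" "hat3 (F + G) = hat3 F + hat3 G" "hat3 (- F) = - hat3 F"
  "hat3 (F - G) = hat3 F - hat3 G"
  "hat3 (fscale c F) = shconst (shconst (shconst c)) * hat3 F"
  by (intro shuf_eqI; simp add: fscale_def coef_shconst_mult)+

lemma hat3_sum: "hat3 (\<Sum>i\<in>S. F i) = (\<Sum>i\<in>S. hat3 (F i))"
  by (induction S rule: infinite_finite_induct)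
    (simp_all add: hat3_simps hat3_simps(1,2)[unfolded zero_fun_def plus_fun_def])

lemma hat4_add: "hat4 (F + G) = hat4 F + hat4 G"
  by (intro shuf_eqI) simp

lemma one3_multilinear: "multilinear3 one3"
  by (simp add: one3_def multilinear3_pure counit_dual)

lemma hat3_one: "hat3 one3 = 1"
  by (intro shuf_eqI) (simp add: one3_def pure3_def counit_cls coef_one)

lemmas dual_intros = pair_comult_dual pair_comult_parameter dual_closed(1,2)

text \<open>Each of the three nested coproduct pairings becomes the shuffle product in one
  layer.\<close>

lemma
  assumes F: "multilinear3 F" and G: "multilinear3 G"
  shows mult3_multilinear: "multilinear3 (mult3 F G)"
    and hat3_mult: "hat3 (mult3 F G) = hat3 F * hat3 G"
proof -
  note intros = dual_intros F[THEN multilinear3D(1)] F[THEN multilinear3D(2)]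
    F[THEN multilinear3D(3)] G[THEN multilinear3D(1)] G[THEN multilinear3D(2)] G[THEN multilinear3D(3)]
  show "multilinear3 (mult3 F G)"
    unfolding multilinear3_def mult3_def prod.case by (intro conjI allI intros)
  have "mult3 F G (cls u, cls v, cls w) = coef (coef (coef (hat3 F * hat3 G) u) v) w" for u v w
  proof -
    have 1: "pair_comult (\<lambda>z1 z2. F (x1, y1, z1) * G (x2, y2, z2)) (cls w) =
        unshuffle_sum (\<lambda>w1 w2. F (x1, y1, cls w1) * G (x2, y2, cls w2)) w" for x1 x2 y1 y2
      by (rule pair_comult_cls) (intro intros)+
    have 2: "pair_comult (\<lambda>y1 y2. pair_comult (\<lambda>z1 z2. F (x1, y1, z1) * G (x2, y2, z2)) z) (cls v) =
        unshuffle_sum (\<lambda>v1 v2. pair_comult (\<lambda>z1 z2.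
          F (x1, cls v1, z1) * G (x2, cls v2, z2)) z) v" for x1 x2 z
      by (rule pair_comult_cls) (intro intros)+
    have 3: "pair_comult (\<lambda>x1 x2. pair_comult (\<lambda>y1 y2. pair_comult (\<lambda>z1 z2.
          F (x1, y1, z1) * G (x2, y2, z2)) z) y) (cls u) =
        unshuffle_sum (\<lambda>u1 u2. pair_comult (\<lambda>y1 y2. pair_comult (\<lambda>z1 z2.
          F (cls u1, y1, z1) * G (cls u2, y2, z2)) z) y) u" for y z
      by (rule pair_comult_cls) (intro intros)+
    show ?thesis
      by (simp add: mult3_def 1 2 3 coef_mult unshuffle_sum_additive[of "\<lambda>f. coef f _"])
  qed
  then show "hat3 (mult3 F G) = hat3 F * hat3 G"
    by (intro shuf_eqI) simp
qed

lemma
  assumes F: "multilinear4 F" and G: "multilinear4 G"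
  shows mult4_multilinear: "multilinear4 (mult4 F G)"
    and hat4_mult: "hat4 (mult4 F G) = hat4 F * hat4 G"
proof -
  note intros = dual_intros F[THEN multilinear4D(1)] F[THEN multilinear4D(2)]
    F[THEN multilinear4D(3)] F[THEN multilinear4D(4)] G[THEN multilinear4D(1)]
    G[THEN multilinear4D(2)] G[THEN multilinear4D(3)] G[THEN multilinear4D(4)]
  show "multilinear4 (mult4 F G)"
    unfolding multilinear4_def mult4_def prod.case by (intro conjI allI intros)
  have "mult4 F G (cls t, cls u, cls v, cls w) =
      coef (coef (coef (coef (hat4 F * hat4 G) t) u) v) w" for t u v w
  proof -
    have 1: "pair_comult (\<lambda>w1 w2. F (x1, y1, z1, w1) * G (x2, y2, z2, w2)) (cls w) =
        unshuffle_sum (\<lambda>w1 w2. F (x1, y1, z1, cls w1) * G (x2, y2, z2, cls w2)) w"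
      for x1 x2 y1 y2 z1 z2
      by (rule pair_comult_cls) (intro intros)+
    have 2: "pair_comult (\<lambda>z1 z2. pair_comult (\<lambda>w1 w2.
          F (x1, y1, z1, w1) * G (x2, y2, z2, w2)) w) (cls v) =
        unshuffle_sum (\<lambda>v1 v2. pair_comult (\<lambda>w1 w2.
          F (x1, y1, cls v1, w1) * G (x2, y2, cls v2, w2)) w) v" for x1 x2 y1 y2 w
      by (rule pair_comult_cls) (intro intros)+
    have 3: "pair_comult (\<lambda>y1 y2. pair_comult (\<lambda>z1 z2. pair_comult (\<lambda>w1 w2.
          F (x1, y1, z1, w1) * G (x2, y2, z2, w2)) w) z) (cls u) =
        unshuffle_sum (\<lambda>u1 u2. pair_comult (\<lambda>z1 z2. pair_comult (\<lambda>w1 w2.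
          F (x1, cls u1, z1, w1) * G (x2, cls u2, z2, w2)) w) z) u" for x1 x2 z w
      by (rule pair_comult_cls) (intro intros)+
    have 4: "pair_comult (\<lambda>x1 x2. pair_comult (\<lambda>y1 y2. pair_comult (\<lambda>z1 z2. pair_comult (\<lambda>w1 w2.
          F (x1, y1, z1, w1) * G (x2, y2, z2, w2)) w) z) y) (cls t) =
        unshuffle_sum (\<lambda>t1 t2. pair_comult (\<lambda>y1 y2. pair_comult (\<lambda>z1 z2. pair_comult (\<lambda>w1 w2.
          F (cls t1, y1, z1, w1) * G (cls t2, y2, z2, w2)) w) z) y) t" for y z w
      by (rule pair_comult_cls) (intro intros)+
    show ?thesis
      by (simp add: mult4_def 1 2 3 4 coef_mult unshuffle_sum_additive[of "\<lambda>f. coef f _"])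
  qed
  then show "hat4 (mult4 F G) = hat4 F * hat4 G"
    by (intro shuf_eqI) simp
qed

lemma dual_if: "f \<in> dual \<Longrightarrow> (\<lambda>x. if P then f x else 0) \<in> dual"
  by (cases P) (simp_all add: dual_zero)

lemma comult_multilinear:
  assumes "multilinear3 F"
  shows "multilinear4 (comult1 F)" "multilinear4 (comult2 F)" "multilinear4 (comult3 F)"
    "multilinear4 (tensor_one_left F)" "multilinear4 (tensor_one_right F)"
  unfolding multilinear4_def comult1_def comult2_def comult3_def dual_comult_def
    tensor_one_left_def tensor_one_right_def prod.case
  using assms[THEN multilinear3D(1)] assms[THEN multilinear3D(2)] assms[THEN multilinear3D(3)]
  by (auto intro!: dual_if dual_uea_mult[where f = "\<lambda>t. F (t, _, _)"]
      dual_uea_mult[where f = "\<lambda>t. F (_, t, _)"] dual_uea_mult[where f = "\<lambda>t. F (_, _, t)"]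
      dual_closed counit_dual)

text \<open>The layer decides the tensor factor: each \<open>shmap\<close> moves an operation one
  factor to the right, and \<open>shconst\<close> inserts a factor 1.\<close>

lemma hat4_comult:
  "hat4 (comult1 F) = deconc (hat3 F)"
  "hat4 (comult2 F) = shmap deconc (hat3 F)"
  "hat4 (comult3 F) = shmap (shmap deconc) (hat3 F)"
  "hat4 (tensor_one_left F) = shconst (hat3 F)"
  "hat4 (tensor_one_right F) = shmap (shmap (shmap shconst)) (hat3 F)"
  by (intro shuf_eqI; simp add: comult1_def comult2_def comult3_def dual_comult_def uea_mult_cls
      tensor_one_left_def tensor_one_right_def counit_cls coef_shconst)+


section \<open>The exponential homomorphism\<close>

lemma aug_ideal_dual: "aug_ideal \<subseteq> dual"
  by (auto simp: aug_ideal_def)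

lemma aug_idealD: "a \<in> aug_ideal \<Longrightarrow> a \<in> dual" "a \<in> aug_ideal \<Longrightarrow> a (cls []) = 0"
  by (simp_all add: aug_ideal_def dual_counit_def uea_one_eq)

lemma aug_ideal_scale: "\<forall>c. \<forall>a\<in>aug_ideal. fscale c a \<in> aug_ideal"
  by (simp add: aug_ideal_def dual_closed) (simp add: dual_counit_def fscale_def)

lemmas aug_tensor3_induct = tensor3_induct[OF _ aug_ideal_scale, consumes 1, case_names zero pure_add]

lemma aug_ideal_zero: "(\<lambda>_. 0) \<in> aug_ideal"
  by (simp add: aug_ideal_def dual_zero dual_counit_def)

lemma aug_ideal_mult:
  assumes "a \<in> aug_ideal" "b \<in> aug_ideal"
  shows "dual_mult a b \<in> aug_ideal"
proof -
  have "(\<lambda>x. a x * b y) \<in> dual" "(\<lambda>y. a x * b y) \<in> dual" for x y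
    using assms by (simp_all add: dual_closed aug_idealD)
  then show ?thesis
    using assms pair_comult_dual[of "\<lambda>x y. a x * b y"] pair_comult_cls[of "\<lambda>x y. a x * b y" "[]"]
    by (simp add: aug_ideal_def dual_mult_def dual_counit_def uea_one_eq)
qed

lemma tensor3_aug_multilinear: "F \<in> tensor3 aug_ideal \<Longrightarrow> multilinear3 F"
  using tensor3_mono[OF aug_ideal_dual] tensor3_dual_multilinear by blast

lemma coef_hat3_aug_Nil:
  assumes "F \<in> tensor3 aug_ideal"
  shows "coef (hat3 F) [] = 0"
proof -
  have "F (cls [], y, z) = 0" for y z
    using assms by (induction rule: aug_tensor3_induct) (auto simp: pure3_def aug_idealD)
  then show ?thesis
    by (intro shuf_eqI) simp
qed

lemma mult3_tensor_aug:
  assumes F: "F \<in> tensor3 aug_ideal" and "G \<in> tensor3 aug_ideal"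
  shows "mult3 F G \<in> tensor3 aug_ideal"
proof -
  have "mult3 (pure3 a b c) G \<in> tensor3 aug_ideal"
    if abc: "a \<in> aug_ideal" "b \<in> aug_ideal" "c \<in> aug_ideal" for a b c
    using assms(2)
  proof (induction rule: aug_tensor3_induct)
    case zero
    have "mult3 (pure3 a b c) 0 = 0"
      using tensor3_aug_multilinear[OF tensor3_pure] abc
      by (intro hat3_inj mult3_multilinear) (simp_all add: multilinear3_closed hat3_mult hat3_simps)
    then show ?case
      by (simp only: tensor3_closed)
  next
    case (pure_add a' b' c' G)
    have "mult3 (pure3 a b c) (pure3 a' b' c' + G) =
        mult3 (pure3 a b c) (pure3 a' b' c') + mult3 (pure3 a b c) G"
      using abc pure_add tensor3_aug_multilinear
      by (intro hat3_inj mult3_multilinear multilinear3_closed)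
        (simp_all add: tensor3_pure mult3_multilinear multilinear3_closed hat3_mult hat3_simps algebra_simps)
    then show ?case
      using abc pure_add by (simp only: mult3_pure tensor3_closed tensor3_pure aug_ideal_mult)
  qed
  note pure = this
  show ?thesis
    using F
  proof (induction rule: aug_tensor3_induct)
    case zero
    have "mult3 0 G = 0"
      using tensor3_aug_multilinear[OF assms(2)]
      by (intro hat3_inj mult3_multilinear) (simp_all add: multilinear3_closed hat3_mult hat3_simps)
    then show ?case
      by (simp only: tensor3_closed)
  next
    case (pure_add a b c F)
    have "mult3 (pure3 a b c + F) G = mult3 (pure3 a b c) G + mult3 F G"
      using assms(2) pure_add tensor3_aug_multilinear
      by (intro hat3_inj mult3_multilinear multilinear3_closed)
        (simp_all add: tensor3_pure mult3_multilinear multilinear3_closed hat3_mult hat3_simps algebra_simps)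
    then show ?case
      using pure_add pure by (simp only: tensor3_closed)
  qed
qed

section \<open>The group \<open>1 + I \<otimes> I \<otimes> I\<close> and the exponential into
  it\<close>

definition unipotent :: "('g, 'k) form3 \<Rightarrow> bool" where
  "unipotent G \<longleftrightarrow> G - one3 \<in> tensor3 aug_ideal"

lemma unipotentE:
  assumes "unipotent G"
  obtains \<tau> where "G = one3 + \<tau>" "\<tau> \<in> tensor3 aug_ideal"
  using assms that[of "G - one3"] by (simp add: unipotent_def)

lemma unipotent_multilinear: "unipotent G \<Longrightarrow> multilinear3 G"
  by (elim unipotentE) (simp add: multilinear3_closed one3_multilinear tensor3_aug_multilinear)

lemma unipotent_mult:
  assumes "unipotent F" "unipotent G"
  shows "unipotent (mult3 F G)"
proof -
  obtain \<tau> \<sigma> where F: "F = one3 + \<tau>" and G: "G = one3 + \<sigma>"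
    and *: "\<tau> \<in> tensor3 aug_ideal" "\<sigma> \<in> tensor3 aug_ideal"
    using assms by (elim unipotentE)
  have "mult3 F G = one3 + (\<tau> + \<sigma> + mult3 \<tau> \<sigma>)"
    using assms * unipotent_multilinear tensor3_aug_multilinear
    by (intro hat3_inj)
      (simp_all add: F G mult3_multilinear multilinear3_closed one3_multilinear hat3_mult hat3_simps
        hat3_one algebra_simps)
  then show ?thesis
    using * by (simp add: unipotent_def tensor3_closed mult3_tensor_aug)
qed

lemma power3_hat:
  assumes "multilinear3 T"
  shows "multilinear3 (power3 T j) \<and> hat3 (power3 T j) = hat3 T ^ j"
  by (induction j)
    (simp_all add: power3_def one3_multilinear hat3_one assms mult3_multilinear hat3_mult)

lemma power3_aug:
  assumes "T \<in> tensor3 aug_ideal"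
  shows "power3 T (Suc j) \<in> tensor3 aug_ideal"
proof (induction j)
  case 0
  have "power3 T (Suc 0) = T"
    using power3_hat[of T "Suc 0"] tensor3_aug_multilinear[OF assms] by (intro hat3_inj) simp_all
  with assms show ?case
    by simp
next
  case (Suc j)
  then show ?case
    using mult3_tensor_aug[OF assms] by (simp add: power3_def)
qed

lemma
  assumes abc: "a \<in> aug_ideal" "b \<in> aug_ideal" "c \<in> aug_ideal"
  shows truncated_exp_unipotent: "unipotent (truncated_exp (pure3 a b c))"
    and hat3_truncated_exp: "hat3 (truncated_exp (pure3 a b c)) = shexp (hat3 (pure3 a b c))"
proof -
  let ?T = "pure3 a b c"
  have T: "?T \<in> tensor3 aug_ideal"
    using abc by (rule tensor3_pure)
  then have lin: "multilinear3 ?T"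
    by (rule tensor3_aug_multilinear)
  obtain q where q: "p = Suc q"
    using char_pos gr0_implies_Suc by blast
  have "(\<Sum>j<p. F j) = F 0 + (\<Sum>j<q. F (Suc j))" for F :: "nat \<Rightarrow> ('g, 'k) form3"
    unfolding q by (rule sum.lessThan_Suc_shift)
  then have "truncated_exp ?T = one3 +
      (\<Sum>j<q. fscale (inverse (of_nat (fact (Suc j)))) (power3 ?T (Suc j)))"
    by (simp only: truncated_exp_def) (simp add: power3_def)
  then show "unipotent (truncated_exp ?T)"
    using T by (simp add: unipotent_def tensor3_sum tensor3_closed power3_aug)
  \<comment> \<open>The tensor is \<open>a \<otimes> s\<close> with
    \<open>s = b \<otimes> c\<close>, and \<open>s ^ p = 0\<close> already because \<open>c\<close>
    has no constant term.\<close>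
  define c' where "c' = Shuf (\<lambda>w. c (cls w))"
  define s where "s = Shuf (\<lambda>v. shconst (b (cls v))) * shconst c'"
  have "c' ^ p = 0"
    by (rule power_char_eq_0) (simp_all add: char_pos c'_def aug_idealD abc)
  then have s: "s ^ p = 0"
    by (simp add: s_def power_mult_distrib shconst_simps flip: shconst_power)
  have hat: "hat3 ?T = Shuf (\<lambda>u. shconst (shconst (a (cls u)))) * shconst s"
    by (intro shuf_eqI) (simp add: s_def c'_def pure3_def coef_mult_shconst coef_shconst_mult mult.assoc)
  let ?k = "\<lambda>j. shconst (shconst (inverse (of_nat (fact j)))) :: ('g, ('g, 'k) shuf) shuf"
  \<comment> \<open>For \<open>Suc j < p\<close> the number \<open>Suc j\<close> is invertible in
    characteristic \<open>p\<close>, so the inverse factorials satisfy the recursion.\<close>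
  have k: "of_nat (Suc j) * ?k (Suc j) = ?k j" if "Suc j < p" for j
  proof -
    have "of_nat (Suc j) \<noteq> (0::'k)"
      using that of_nat_eq_0_iff_char_dvd[where 'a = 'k, of "Suc j"] char_eq nat_dvd_not_less[of "Suc j" p]
      by (auto simp del: of_nat_Suc)
    then have "of_nat (Suc j) * inverse (of_nat (fact (Suc j))) = (inverse (of_nat (fact j)) :: 'k)"
      by (simp only: fact_Suc of_nat_mult of_nat_id inverse_mult_distrib) simp
    then show ?thesis
      unfolding of_nat_shuf by (simp only: flip: shconst_simps)
  qed
  have "hat3 (truncated_exp ?T) = (\<Sum>j<p. shconst (?k j) * hat3 ?T ^ j)"
    by (simp add: truncated_exp_def hat3_sum hat3_simps power3_hat[OF lin])
  also have "\<dots> = shexp (hat3 ?T)"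
  proof (rule shexp_eq_truncated_exp)
    show "hat3 ?T ^ (p - 1) * der x (hat3 ?T) = 0" for x
      unfolding hat by (rule power_mult_der_eq_0[OF s char_pos])
    show "?k 0 = 1"
      by (simp add: shconst_simps)
  qed (simp_all only: char_pos k coef_hat3_aug_Nil[OF T])
  finally show "hat3 (truncated_exp ?T) = shexp (hat3 ?T)" .
qed

text \<open>A priori \<open>shexp (hat3 \<phi>)\<close> is only a function of words. It comes from a
  form in the group because \<phi> is a sum of pure tensors, whose truncated exponentials can be
  multiplied.\<close>

lemma ex_unipotent_exp:
  assumes "\<phi> \<in> tensor3 aug_ideal"
  shows "\<exists>G. unipotent G \<and> hat3 G = shexp (hat3 \<phi>)"
  using assms
proof (induction rule: aug_tensor3_induct)
  case zero
  then show ?case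
    by (intro exI[of _ one3]) (simp add: unipotent_def tensor3_closed hat3_one hat3_simps flip: zero_fun_def)
next
  case (pure_add a b c F)
  then obtain G where G: "unipotent G" "hat3 G = shexp (hat3 F)"
    by blast
  show ?case
  proof (intro exI conjI)
    show "unipotent (mult3 (truncated_exp (pure3 a b c)) G)"
      using pure_add G by (simp add: unipotent_mult truncated_exp_unipotent)
    show "hat3 (mult3 (truncated_exp (pure3 a b c)) G) = shexp (hat3 (pure3 a b c + F))"
      using pure_add G by (simp add: hat3_mult unipotent_multilinear truncated_exp_unipotent
        hat3_truncated_exp hat3_simps shexp_add)
  qed
qed

text \<open>The choice is unique because \<open>hat3\<close> is injective on multilinear forms; the
  default value matches \<open>extensional\<close>.\<close>

definition exp_form :: "('g, 'k) form3 \<Rightarrow> ('g, 'k) form3" where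
  "exp_form \<phi> = (if \<phi> \<in> tensor3 aug_ideal
     then SOME G. unipotent G \<and> hat3 G = shexp (hat3 \<phi>) else undefined)"

lemma exp_form:
  assumes "\<phi> \<in> tensor3 aug_ideal"
  shows "unipotent (exp_form \<phi>)" "hat3 (exp_form \<phi>) = shexp (hat3 \<phi>)"
  using someI_ex[OF ex_unipotent_exp[OF assms]] assms by (simp_all add: exp_form_def)

lemma unipotent_eqI: "unipotent F \<Longrightarrow> unipotent G \<Longrightarrow> hat3 F = hat3 G \<Longrightarrow> F = G"
  by (simp add: hat3_inj unipotent_multilinear)

lemma multilinear3_coset:
  assumes "multilinear3 F"
  shows "F (coset r, coset s, coset t) = lin (\<lambda>u. lin (\<lambda>v. lin (\<lambda>w.
    F (cls (letters u), cls (letters v), cls (letters w))) t) s) r"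
proof -
  have "F (coset r, coset s, coset t) = lin (\<lambda>u. F (cls (letters u), coset s, coset t)) r"
    by (rule dual_coset[OF assms[THEN multilinear3D(1)]])
  also have "\<dots> = lin (\<lambda>u. lin (\<lambda>v. F (cls (letters u), cls (letters v), coset t)) s) r"
    by (simp only: dual_coset[OF assms[THEN multilinear3D(2)]])
  finally show ?thesis
    by (simp only: dual_coset[OF assms[THEN multilinear3D(3)]])
qed

text \<open>A coordinate is a fixed linear combination of values at words, and each of these is a
  polynomial in the coordinates of \<phi> by the recursion for \<open>shexp\<close>.\<close>

lemma exp_form_regular: "regular_map_on (tensor3 aug_ideal) exp_form"
  unfolding regular_map_on_def
proof
  fix Y :: "('g, 'k) residue_class \<times> ('g, 'k) residue_class \<times> ('g, 'k) residue_class"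
  obtain x y z where Y: "Y = (x, y, z)"
    by (cases Y) auto
  show "\<exists>r\<in>poly_functions. \<forall>\<phi>\<in>tensor3 aug_ideal. exp_form \<phi> Y = r \<phi>"
  proof (cases "x \<in> uea \<and> y \<in> uea \<and> z \<in> uea")
    case True
    then obtain r s t where rst: "x = coset r" "y = coset s" "z = coset t"
      by (auto simp: uea_def)
    let ?P = "coefficientwise (coefficientwise poly_functions)"
    have "(\<lambda>\<phi>. shexp (hat3 \<phi>)) \<in> coefficientwise ?P"
      by (intro coefficientwise_shexp function_subring_coefficientwise function_subring_poly_functions)
        (simp add: coefficientwise_def poly_functions.coord)
    moreover define R where "R = (\<lambda>\<phi>. lin (\<lambda>u. lin (\<lambda>v. lin (\<lambda>w. coef (coef (coef (shexp (hat3 \<phi>))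
        (letters u)) (letters v)) (letters w)) t) s) r)"
    ultimately have "R \<in> poly_functions"
      unfolding R_def by (intro poly_functions_lin) (simp add: coefficientwise_def)
    moreover have "exp_form \<phi> Y = R \<phi>" if "\<phi> \<in> tensor3 aug_ideal" for \<phi>
      using multilinear3_coset[OF unipotent_multilinear[OF exp_form(1)[OF that]]]
      by (simp add: Y rst R_def flip: exp_form(2)[OF that])
    ultimately show ?thesis
      by blast
  next
    case False
    \<comment> \<open>A multilinear form vanishes as soon as one argument lies outside
      \<open>uea\<close>.\<close>
    have "exp_form \<phi> Y = 0" if "\<phi> \<in> tensor3 aug_ideal" for \<phi>
      using False dual_outside[OF multilinear3D(1)[OF unipotent_multilinear[OF exp_form(1)[OF that]]]]
        dual_outside[OF multilinear3D(2)[OF unipotent_multilinear[OF exp_form(1)[OF that]]]]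
        dual_outside[OF multilinear3D(3)[OF unipotent_multilinear[OF exp_form(1)[OF that]]]]
      by (auto simp: Y)
    then show ?thesis
      using poly_functions.const[of 0] by force
  qed
qed

lemma exp_form_unipotent_hom: "unipotent_hom exp_form"
  unfolding unipotent_hom_def
proof (intro conjI ballI)
  show "exp_form \<in> extensional (tensor3 aug_ideal)"
    by (simp add: extensional_def exp_form_def)
  show "exp_form ` tensor3 aug_ideal \<subseteq> {one3 + \<tau> |\<tau>. \<tau> \<in> tensor3 aug_ideal}"
    using exp_form(1) by (auto elim!: unipotentE)
  show "exp_form (\<phi> + \<psi>) = mult3 (exp_form \<phi>) (exp_form \<psi>)"
    if "\<phi> \<in> tensor3 aug_ideal" "\<psi> \<in> tensor3 aug_ideal" for \<phi> \<psi>
    using that by (intro unipotent_eqI)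
      (simp_all add: exp_form tensor3_closed unipotent_mult hat3_mult unipotent_multilinear
        hat3_simps shexp_add)
qed (rule exp_form_regular)

lemma exp_form_pure:
  assumes "a \<in> aug_ideal" "b \<in> aug_ideal" "c \<in> aug_ideal"
  shows "exp_form (pure3 a b c) = truncated_exp (pure3 a b c)"
  using assms
  by (intro unipotent_eqI) (simp_all add: exp_form tensor3_pure truncated_exp_unipotent hat3_truncated_exp)

text \<open>A homomorphism is fixed by its values on pure tensors, which generate the additive
  group; extensionality fixes it elsewhere.\<close>

lemma exp_hom_eq: "exp_hom = exp_form"
  unfolding exp_hom_def
proof (rule the_equality)
  show "unipotent_hom exp_form \<and> (\<forall>a\<in>aug_ideal. \<forall>b\<in>aug_ideal. \<forall>c\<in>aug_ideal.
      exp_form (pure3 a b c) = truncated_exp (pure3 a b c))"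
    by (simp add: exp_form_unipotent_hom exp_form_pure)
next
  fix E assume E: "unipotent_hom E \<and> (\<forall>a\<in>aug_ideal. \<forall>b\<in>aug_ideal. \<forall>c\<in>aug_ideal.
      E (pure3 a b c) = truncated_exp (pure3 a b c))"
  have "E \<phi> = exp_form \<phi>" if "\<phi> \<in> tensor3 aug_ideal" for \<phi>
    using that
  proof (induction rule: aug_tensor3_induct)
    case zero
    \<comment> \<open>The zero tensor is itself pure, so its image is prescribed as well.\<close>
    have "E (pure3 (\<lambda>_. 0) (\<lambda>_. 0) (\<lambda>_. 0)) = exp_form (pure3 (\<lambda>_. 0) (\<lambda>_. 0) (\<lambda>_. 0))"
      using E by (simp add: exp_form_pure aug_ideal_zero)
    then show ?case
      by (simp only: pure3_zero zero_fun_def)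
  next
    case (pure_add a b c F)
    have "H (pure3 a b c + F) = mult3 (H (pure3 a b c)) (H F)" if "unipotent_hom H" for H
      using that pure_add tensor3_pure unfolding unipotent_hom_def by blast
    then show ?case
      using E exp_form_unipotent_hom pure_add by (simp only: exp_form_pure)
  qed
  then show "E = exp_form"
    using E exp_form_unipotent_hom
    by (intro extensionalityI[of _ "tensor3 aug_ideal"]) (simp_all add: unipotent_hom_def)
qed


section \<open>Surjectivity\<close>

text \<open>The spanning half of the restricted Poincare-Birkhoff-Witt theorem: modulo shorter words
  letters commute, \<open>p\<close> equal letters in a row collapse to the single letter
  \<open>pmap b\<close>, and a long word over \<open>B\<close> contains some letter \<open>p\<close>
  times.\<close>

lemma invariant_eq_0_of_short_words:
  assumes B: "finite B" "span B = UNIV" and g: "invariant g"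
    and short: "\<And>w. length w \<le> card B * (p - 1) \<Longrightarrow> g w = 0"
  shows "g w = 0"
proof (induction "length w" arbitrary: w rule: less_induct)
  case less
  define n where "n = length w"
  have IH: "g v = 0" if "length v < n" for v
    using less that by (simp add: n_def)
  have add: "g (u @ (x + y) # v) = g (u @ x # v) + g (u @ y # v)"
    and scal: "g (u @ scale c x # v) = c * g (u @ x # v)"
    and bracket: "g (u @ br x y # v) = g (u @ x # y # v) - g (u @ y # x # v)"
    and pth: "g (u @ pmap x # v) = g (u @ replicate p x @ v)" for u v x y c
    using g by (simp_all add: invariant_iff)
  have swap: "g (u @ x # y # v) = g (u @ y # x # v)" if "length (u @ x # y # v) = n" for u v x y
    using bracket[of u x y v] IH[of "u @ br x y # v"] that by simp
  have front: "g (t @ u @ x # v) = g (t @ x # u @ v)" if "length (t @ u @ x # v) = n" for t u v x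
    using that
  proof (induction u arbitrary: t)
    case (Cons y u)
    then show ?case
      using Cons.IH[of "t @ [y]"] swap[of t y x "u @ v"] by simp
  qed simp
  have collect: "\<exists>v. length v + k = n \<and> count_list v b + k = count_list w b \<and> g w = g (replicate k b @ v)"
    if "k \<le> count_list w b" "length w = n" for k b w
    using that
  proof (induction k)
    case 0
    then show ?case
      by (intro exI[of _ w]) simp
  next
    case (Suc k)
    then obtain v where v: "length v + k = n" "count_list v b + k = count_list w b"
      "g w = g (replicate k b @ v)"
      by auto
    then have "b \<in> set v"
      using Suc.prems(1) count_list_0_iff[of v b] by (cases "b \<in> set v") simp_all
    then obtain v1 v2 where "v = v1 @ b # v2"
      by (meson split_list)
    with v front[of "replicate k b" v1 b v2] show ?case
      by (intro exI[of _ "v1 @ v2"]) (simp add: replicate_app_Cons_same)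
  qed
  have in_B: "g w = 0" if w: "set w \<subseteq> B" "length w = n" for w
  proof (cases "n \<le> card B * (p - 1)")
    case True
    then show ?thesis
      using short w by simp
  next
    case False
    \<comment> \<open>Pigeonhole: otherwise each of the \<open>card B\<close> letters occurs at most
      \<open>p - 1\<close> times.\<close>
    have "\<exists>b\<in>B. p \<le> count_list w b"
    proof (rule ccontr)
      assume "\<not> ?thesis"
      then have "count_list w b \<le> p - 1" if "b \<in> B" for b
        using that by force
      then have "sum (count_list w) B \<le> card B * (p - 1)"
        using sum_bounded_above[of B "count_list w" "p - 1"] by simp
      then show False
        using False sum_count_set[OF w(1) B(1)] w(2) by simp
    qed
    then obtain b where "p \<le> count_list w b"
      by blast
    then obtain v where "length v + p = n" "g w = g (replicate p b @ v)"
      using collect[OF _ w(2)] by blast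
    \<comment> \<open>Since \<open>p > 1\<close>, the word \<open>pmap b # v\<close> is shorter than
      \<open>w\<close>.\<close>
    then show ?thesis
      using IH[of "pmap b # v"] pth[of "[]" b v] prime_gt_1_nat[OF prime_char] by simp
  qed
  \<comment> \<open>The letters of an arbitrary word are expanded in \<open>B\<close> one after the
    other; \<open>u\<close> is the part already treated.\<close>
  have "g (u @ v) = 0" if "set u \<subseteq> B" "length (u @ v) = n" for u v
    using that
  proof (induction v arbitrary: u)
    case (Cons x v)
    have "x \<in> span B"
      by (simp add: B)
    then show ?case
    proof (induction rule: span_induct_alt)
      case base
      then show ?case
        using scal[of u 0 0 v] by simp
    next
      case (step c y z)
      then show ?case
        using Cons.IH[of "u @ [y]"] Cons.prems by (simp add: add scal)
    qed
  qed (simp add: in_B)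
  from this[of "[]" w] show ?case
    by (simp add: n_def)
qed

lemma dual_finite_length:
  assumes "finite B" "span B = UNIV"
  shows "\<exists>M. \<forall>f\<in>dual. (\<forall>w. length w \<le> M \<longrightarrow> f (cls w) = 0) \<longrightarrow> (\<forall>w. f (cls w) = 0)"
  using invariant_eq_0_of_short_words[OF assms dual_invariant] by blast

text \<open>Induction on \<open>Suc M - n\<close>: while \<open>n \<le> M\<close>, multiplication by
  \<open>exp_form (- \<tau>)\<close> removes the leading part of the deviation \<tau> from
  \<open>one3\<close> and raises the order of vanishing.\<close>

lemma exp_form_surjective:
  assumes B: "finite B" "span B = UNIV" and \<Phi>: "unipotent \<Phi>"
  shows "\<exists>\<phi>\<in>tensor3 aug_ideal. \<Phi> = exp_form \<phi>"
proof -
  obtain M where M: "\<And>f w. f \<in> dual \<Longrightarrow> (\<And>v. length v \<le> M \<Longrightarrow> f (cls v) = 0) \<Longrightarrow> f (cls w) = 0"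
    using dual_finite_length[OF B] by blast
  have "\<exists>\<phi>\<in>tensor3 aug_ideal. \<Phi> = exp_form \<phi>"
    if "unipotent \<Phi>" "vanishes_below (Suc n) (hat3 \<Phi> - 1)" for n \<Phi>
    using that
  proof (induction "Suc M - n" arbitrary: n \<Phi> rule: less_induct)
    case less
    obtain \<tau> where \<tau>: "\<Phi> = one3 + \<tau>" "\<tau> \<in> tensor3 aug_ideal"
      using less.prems(1) by (rule unipotentE)
    have hat: "hat3 \<Phi> = 1 + hat3 \<tau>"
      by (simp add: \<tau> hat3_simps hat3_one)
    have van: "vanishes_below (Suc n) (hat3 \<tau>)"
      using less.prems(2) by (simp add: hat)
    show ?case
    proof (cases "n \<le> M")
      case True
      let ?\<Psi> = "mult3 (exp_form (- \<tau>)) \<Phi>"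
      have neg: "- \<tau> \<in> tensor3 aug_ideal"
        by (simp add: \<tau> tensor3_closed)
      have \<Psi>: "unipotent ?\<Psi>" "hat3 ?\<Psi> = shexp (- hat3 \<tau>) * hat3 \<Phi>"
        using less.prems(1)
        by (simp_all add: unipotent_mult exp_form neg hat3_mult unipotent_multilinear hat3_simps)
      have "vanishes_below (Suc (Suc n)) (hat3 ?\<Psi> - 1)"
        using shexp_correction[OF van] by (simp add: \<Psi> hat)
      then obtain \<psi> where \<psi>: "\<psi> \<in> tensor3 aug_ideal" "?\<Psi> = exp_form \<psi>"
        using less.hyps[of "Suc n" ?\<Psi>] True \<Psi>(1) by (auto simp: Suc_diff_le)
      have "hat3 \<Phi> = shexp (hat3 \<tau>) * (shexp (- hat3 \<tau>) * hat3 \<Phi>)"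
        by (simp add: shexp_uminus flip: mult.assoc)
      also have "\<dots> = shexp (hat3 \<tau>) * shexp (hat3 \<psi>)"
        using \<Psi>(2) \<psi> exp_form(2) by simp
      finally have "\<Phi> = exp_form (\<tau> + \<psi>)"
        using less.prems(1) \<tau>(2) \<psi>(1)
        by (intro unipotent_eqI) (simp_all add: exp_form tensor3_closed hat3_simps shexp_add)
      then show ?thesis
        using \<tau>(2) \<psi>(1) tensor3_closed(2) by blast
    next
      case False
      \<comment> \<open>Here \<tau> vanishes on all first words of length at most \<open>M\<close>,
        and so on all words by the choice of \<open>M\<close>.\<close>
      have "\<tau> (cls u, cls v, cls w) = 0" for u v w
      proof (rule M[of "\<lambda>x. \<tau> (x, cls v, cls w)"])
        show "(\<lambda>x. \<tau> (x, cls v, cls w)) \<in> dual"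
          using \<tau>(2) by (simp add: tensor3_aug_multilinear multilinear3D)
        show "\<tau> (cls u', cls v, cls w) = 0" if "length u' \<le> M" for u'
          using van that False unfolding vanishes_below_def
          by (metis coef_hat3 coef_simps(1) le_trans less_Suc_eq_le nat_le_linear)
      qed
      then have "hat3 \<tau> = 0"
        by (intro shuf_eqI) simp
      then have "\<Phi> = exp_form 0"
        using less.prems(1)
        by (intro unipotent_eqI) (simp_all add: exp_form tensor3_closed hat hat3_simps)
      then show ?thesis
        using tensor3_closed(1) by blast
    qed
  qed
  \<comment> \<open>The start: forms in the augmentation ideal vanish at the empty word.\<close>
  moreover have "vanishes_below (Suc 0) (hat3 \<Phi> - 1)"
  proof -
    obtain \<tau> where \<tau>: "\<Phi> = one3 + \<tau>" "\<tau> \<in> tensor3 aug_ideal"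
      using \<Phi> by (rule unipotentE)
    then show ?thesis
      by (simp add: vanishes_below_def hat3_simps hat3_one coef_hat3_aug_Nil)
  qed
  ultimately show ?thesis
    using \<Phi> by blast
qed


section \<open>Associators\<close>

text \<open>Applying \<open>id - 1 \<epsilon>\<close> to each tensor factor projects onto the tensors of the augmentation ideal;
  by the counit axioms it sends \<open>\<Phi>\<close> to \<open>\<Phi> - 1\<close>.\<close>

lemma associator_unipotent:
  assumes "associator \<Phi>"
  shows "unipotent \<Phi>"
proof -
  let ?e = uea_counit and ?o = "cls []"
  define N :: "('g, 'k) form3 \<Rightarrow> ('g, 'k) form3" where
    "N F = (\<lambda>(x, y, z). F (x, y, z) - ?e x * F (?o, y, z) - ?e y * F (x, ?o, z) - ?e z * F (x, y, ?o)
       + ?e x * ?e y * F (?o, ?o, z) + ?e x * ?e z * F (?o, y, ?o) + ?e y * ?e z * F (x, ?o, ?o)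
       - ?e x * ?e y * ?e z * F (?o, ?o, ?o))" for F
  have N_add: "N (F + G) = N F + N G" and N_zero: "N 0 = 0" for F G
    by (auto simp: N_def fun_eq_iff algebra_simps)
  define \<pi> where "\<pi> a = (\<lambda>x. a x - ?e x * a ?o)" for a
  have \<pi>: "\<pi> a \<in> aug_ideal" if "a \<in> dual" for a
    using dual_add[OF that dual_closed(1)[OF counit_dual, of "- a ?o"]]
    by (simp add: \<pi>_def aug_ideal_def dual_counit_def uea_one_eq counit_cls)
  have N_pure: "N (pure3 a b c) = pure3 (\<pi> a) (\<pi> b) (\<pi> c)" for a b c
    by (auto simp: N_def \<pi>_def pure3_def algebra_simps)
  have "N F \<in> tensor3 aug_ideal" if "F \<in> tensor3 dual" for F
  proof -
    have "\<forall>c. \<forall>a\<in>dual. fscale c a \<in> dual"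
      by (simp add: dual_closed)
    with that show ?thesis
      by (induction rule: tensor3_induct) (simp_all only: N_zero N_add N_pure tensor3_closed tensor3_pure \<pi>)
  qed
  then have "N \<Phi> \<in> tensor3 aug_ideal"
    using assms by (simp add: associator_def)
  \<comment> \<open>By the counit axioms each of the seven correction terms is plus or minus
    \<open>one3\<close>, and the signs add up to -3 + 3 - 1 = -1.\<close>
  moreover have "N \<Phi> = \<Phi> - one3"
  proof -
    have "\<Phi> (?o, y, z) = ?e y * ?e z" "\<Phi> (x, ?o, z) = ?e x * ?e z" "\<Phi> (x, y, ?o) = ?e x * ?e y" for x y z
      using assms unfolding associator_def counit1_def counit2_def counit3_def dual_counit_def
        uea_one_eq one2_def pure2_def fun_eq_iff
      by simp_all
    then show ?thesis
      by (auto simp: N_def one3_def pure3_def counit_cls algebra_simps)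
  qed
  ultimately show ?thesis
    by (simp add: unipotent_def)
qed

text \<open>Equal logarithmic derivatives leave only the constant term in the first word, and that
  is 0 on the augmentation ideal.\<close>

lemma exp_form_inject:
  assumes "\<phi> \<in> tensor3 aug_ideal" "\<psi> \<in> tensor3 aug_ideal" "exp_form \<phi> = exp_form \<psi>"
  shows "\<phi> = \<psi>"
proof (rule hat3_inj)
  have "shexp (hat3 \<phi>) = shexp (hat3 \<psi>)"
    using assms exp_form(2) by metis
  then have "der x (hat3 \<phi>) = der x (hat3 \<psi>)" for x
    by (rule shexp_eq_imp_der_eq)
  moreover have "coef (hat3 \<phi>) [] = coef (hat3 \<psi>) []"
    using assms by (simp add: coef_hat3_aug_Nil)
  ultimately show "hat3 \<phi> = hat3 \<psi>"
    using shuf_eq_derI by blast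
qed (simp_all add: assms tensor3_aug_multilinear)

text \<open>\<open>hat4\<close> carries the pentagon to the shuffle algebra, and its injectivity on
  multilinear forms brings the additive equation back.\<close>

lemma associator_exp_form_cocycle:
  assumes \<phi>: "\<phi> \<in> tensor3 aug_ideal" and "associator (exp_form \<phi>)"
  shows "\<phi> \<in> cocycles3"
proof -
  let ?\<Phi> = "exp_form \<phi>"
  have lin: "multilinear3 ?\<Phi>" "multilinear3 \<phi>"
    using \<phi> by (simp_all add: exp_form unipotent_multilinear tensor3_aug_multilinear)
  have "hat4 (mult4 (comult3 ?\<Phi>) (comult1 ?\<Phi>)) =
      hat4 (mult4 (mult4 (tensor_one_left ?\<Phi>) (comult2 ?\<Phi>)) (tensor_one_right ?\<Phi>))"
    using assms(2) by (simp add: associator_def)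
  then have "shmap (shmap deconc) (hat3 \<phi>) + deconc (hat3 \<phi>) =
      shconst (hat3 \<phi>) + shmap deconc (hat3 \<phi>) + shmap (shmap (shmap shconst)) (hat3 \<phi>)"
    by (intro shexp_pentagon_imp_cocycle)
      (simp_all add: hat4_mult mult4_multilinear comult_multilinear lin hat4_comult exp_form \<phi>
        coef_hat3_aug_Nil)
  then have "hat4 (comult3 \<phi> + comult1 \<phi>) = hat4 (tensor_one_left \<phi> + comult2 \<phi> + tensor_one_right \<phi>)"
    by (simp only: hat4_add hat4_comult)
  then have "comult3 \<phi> + comult1 \<phi> = tensor_one_left \<phi> + comult2 \<phi> + tensor_one_right \<phi>"
    by (intro hat4_inj multilinear4_add comult_multilinear lin)
  then show ?thesis
    using \<phi> by (simp add: cocycles3_def)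
qed

lemma associator_eq_exp_hom:
  assumes "finite B" "span B = UNIV" and \<Phi>: "associator \<Phi>"
  shows "\<exists>!\<phi>. \<phi> \<in> cocycles3 \<and> \<Phi> = exp_hom \<phi>"
proof -
  obtain \<phi> where "\<phi> \<in> tensor3 aug_ideal" "\<Phi> = exp_form \<phi>"
    using exp_form_surjective[OF assms(1,2) associator_unipotent[OF \<Phi>]] by blast
  moreover from this have "\<phi> \<in> cocycles3"
    using associator_exp_form_cocycle \<Phi> by blast
  ultimately show ?thesis
    unfolding exp_hom_eq by (intro ex1I[of _ \<phi>]) (auto simp: cocycles3_def intro: exp_form_inject)
qed

end

theorem corollary5p14:
  fixes p :: nat
    and scale :: "'k::alg_closed_field \<Rightarrow> 'g::ab_group_add \<Rightarrow> 'g"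
    and br :: "'g \<Rightarrow> 'g \<Rightarrow> 'g"
    and pmap :: "'g \<Rightarrow> 'g"
    and \<Phi> :: "('g, 'k) form3"
  assumes "p > 0" and "CHAR('k) = p"
    and "restricted_lie_algebra scale p br pmap"
    and "\<exists>B. finite B \<and> module.span scale B = UNIV"
    and "restricted_lie_algebra.associator scale p br pmap \<Phi>"
  shows "\<exists>!\<phi>. \<phi> \<in> restricted_lie_algebra.cocycles3 scale p br pmap \<and>
              \<Phi> = restricted_lie_algebra.exp_hom scale p br pmap \<phi>"
proof -
  interpret restricted_lie_algebra scale p br pmap
    by fact
  obtain B where "finite B" "span B = UNIV"
    using assms(4) by blast
  then show ?thesis
    using assms(5) by (rule associator_eq_exp_hom)
qed

end
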